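(* Let $p>c>0$, let $\mu>0$ and $\sigma\ge0$ be the mean and standard deviation of demand, and put $\beta:=c/p$, $r:=\sigma/\mu$. Let $h\in\mathcal H_2:=\{h\in\mathcal H:\int_0^1(h'(u))^2\,du<\infty\}$, and define $s^*:=h^{-1}(\beta)$, $$\Delta_{s^*,t}:=\sqrt{t\int_{s^*}^{t}(h'(u))^2\,du-(h(t)-\beta)^2},\ t\ge s^*,\qquad \sigma_t:=\sqrt{t(\mu^2+\sigma^2)-\mu^2},\ t\in\Big[\tfrac1{1+r^2},1\Big].$$ Then the optimal order quantity for the problem $$\rho_h^{\rm wc}(\mu,\sigma):=\min_{x\ge 0}\ \sup_{F\in\mathcal S(\mu,\sigma)}\rho_h^F\big(\psi(x,p,c)\big)$$ satisfies one of the following: (i) (High demand uncertainty) If $r\ge\sqrt{1/s^*-1}$, then $\rho_h^{\rm wc}(\mu,\sigma)=0$, the optimal order quantity is $x^*=0$, and the worst-case distribution is $$\mathbb P\Big(S^*=\frac{\mu^2+\sigma^2}{\mu}\Big)=\frac1{1+r^2}=1-\mathbb P(S^*=0).$$ (ii) (Low demand uncertainty) If $r\le\dfrac{\Delta_{s^*,1}}{h'(1)-(1-\beta)}$, then $\rho_h^{\rm wc}(\mu,\sigma)=-\mu(p-c)+p\,\sigma\,\Delta_{s^*,1}$, the optimal order quantity is $$x^*=\mu-\sigma\,\frac{h^\tau(s^* )-2(1-\beta)}{2\Delta_{s^*,1}},$$ where $h^\tau(s)$ is any value in $[h'(s),h'(s+)]$, and the worst-case distribution is $$F^{-1}(u)=\mu-\sigma\frac{h'(1-u)}{\Delta_{s^*,1}}\mathbf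 1_{\{u<1-s^*\}}+\sigma\frac{1-\beta}{\Delta_{s^*,1}}.$$ (iii) (Intermediate demand uncertainty) If $\dfrac{\Delta_{s^*,1}}{h'(1)-(1-\beta)}<r<\sqrt{1/s^*-1}$, then $$\rho_h^{\rm wc}(\mu,\sigma)=\frac p{t^*}\Big[-\mu\,(h(t^* )-\beta)+\sigma_{t^*}\Delta_{s^*,t^*}\Big],$$ the optimal order quantity is $$x^*=\frac{\mu}{t^*}-\frac{\sigma_{t^*}}{t^*}\,\frac{t^*h^\tau(s^* )-2(h(t^* )-\beta)}{2\Delta_{s^*,t^*}},$$ and the worst-case distribution is $$F^{-1}(u)=\begin{cases}0,&u<1-t^*,\\[2pt] \dfrac{\mu}{t^*}-\dfrac{\sigma_{t^*}}{t^*}\,\dfrac{t^*h'(1-u)-(h(t^* )-(1-\beta))}{\Delta_{s^*,t^*}},&1-t^*\le u<1-s^*,\\[6pt] \dfrac{\mu}{t^*}+\dfrac{\sigma_{t^*}}{t^*}\,\dfrac{h(t^* )-(1-\beta)}{\Delta_{s^*,t^*}},&u\ge 1-s^*,\end{cases}$$ where $$t^*=\max\Big\{t\in\Big[\tfrac1{1+r^2},1\Big]\ \Big|\ (1+r^2)\big(t\,h'(t)-h(t)+\beta\big)^2-\int_0^1\big(h'(u)-h(t)+\beta\big)^2du\le 0\Big\}.$$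
   Context: $\mathcal H$ is the set of all convex distortion functions, i.e. non-decreasing convex $h:[0,1]\to[0,1]$ with $h(0)=0$, $h(1)=1$. $h'$ denotes the left-continuous function equal to the left derivative of $h$ on $(0,1]$, with $h'(0)$ the right derivative of $h$ at $0$; $h'(s+)$ is the right limit of $h'$ at $s$. The distortion functional is $\rho_h(X)=\int_0^1\mathrm{VaR}_\alpha(X)\,dh(\alpha)$ with $\mathrm{VaR}_\alpha(X)=\inf\{x:\mathbb P(X\le x)\ge\alpha\}$. $\mathcal S(\mu,\sigma)$ is the set of cdfs $F$ on $[0,\infty)$ with $\mathbb E_F[S]=\mu$ and $\mathbb E_F[S^2]=\mu^2+\sigma^2$, where $S\sim F$ is the demand. The loss from ordering $x\ge0$ units at unit cost $c$ and selling at unit price $p$ is $\psi(x,p,c)=-(p\min\{S,x\}-cx)$, and $\rho_h^F(\psi(x,p,c))$ is its $\rho_h$-value when $S\sim F$. For given $x\ge0$, a worst-case distribution is an optimal distribution $F$ of the inner problem $\sup_{F\in\mathcal S(\mu,\sigma)}\rho_h^F(\psi(x,p,c))$; $F^{-1}$ denotes its quantile function (that of the demand).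
   Formalization: In (iii) the printed quantile (mean not μ unless β=1/2) and t* (fails for h(u)=u², β=1/4, r=4/5) are corrected: h(t* )-(1-β) becomes h(t* )-β, and the integral becomes ∫_0^t (h'(t)-h'(u)1_{u>s*})² du with h'(t) finite. H_2 is read as requiring h continuous at 1. *)

theory Defs
  imports "HOL-Probability.Probability"
begin

definition convex_distortion :: "(real \<Rightarrow> real) \<Rightarrow> bool" where
  "convex_distortion h \<longleftrightarrow>
     h ` {0..1} \<subseteq> {0..1} \<and> mono_on {0..1} h \<and> convex_on {0..1} h \<and> h 0 = 0 \<and> h 1 = 1"

text \<open>The function \<open>h'\<close>: the left derivative on \<open>(0,1]\<close> and the right derivative at 0.
  It is extended real valued because \<open>h'(1)\<close> may be infinite for a convex distortion
  function, even for a continuous one with square integrable derivative, such as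
  \<open>h(u) = 1 - (1 - u) powr (3/4)\<close>. On \<open>[0,1)\<close> it is finite.\<close>

definition hderiv :: "(real \<Rightarrow> real) \<Rightarrow> real \<Rightarrow> ereal" where
  "hderiv h u =
     (if u = 0 then Lim (at_right 0) (\<lambda>v. ereal ((h v - h 0) / v))
      else Lim (at_left u) (\<lambda>v. ereal ((h u - h v) / (u - v))))"

abbreviation hder :: "(real \<Rightarrow> real) \<Rightarrow> real \<Rightarrow> real" where
  "hder h u \<equiv> real_of_ereal (hderiv h u)"

definition hderiv_right_limit :: "(real \<Rightarrow> real) \<Rightarrow> real \<Rightarrow> ereal" where
  "hderiv_right_limit h u = Lim (at_right u) (hderiv h)"

text \<open>The class \<open>H\<^sub>2\<close>. A convex distortion function is continuous on \<open>[0,1)\<close>, but it may jump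
  at 1, where \<open>dh\<close> then has an atom and is not given by a square integrable density. Continuity
  excludes this case, which the Lebesgue integral of the squared pointwise derivative does not see.\<close>

definition convex_distortion_L2 :: "(real \<Rightarrow> real) \<Rightarrow> bool" where
  "convex_distortion_L2 h \<longleftrightarrow>
     convex_distortion h \<and> continuous_on {0..1} h \<and>
     set_integrable lborel {0..1} (\<lambda>u. (hder h u)\<^sup>2)"

definition VaR :: "'a measure \<Rightarrow> ('a \<Rightarrow> real) \<Rightarrow> real \<Rightarrow> real" where
  "VaR M X \<alpha> = Inf {x. \<alpha> \<le> measure M {w \<in> space M. X w \<le> x}}"

text \<open>The Lebesgue--Stieltjes measure \<open>dh\<close> on \<open>[0,1]\<close>.\<close>

definition distortion_measure :: "(real \<Rightarrow> real) \<Rightarrow> real measure" where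
  "distortion_measure h =
     interval_measure (\<lambda>u. if u < 0 then 0 else if 1 < u then 1 else h u)"

text \<open>The integral is taken over \<open>(0,1]\<close>: \<open>dh\<close> has no atom at 0, and \<open>VaR\<close> at level 0 is the
  infimum of all reals, i.e. minus infinity mathematically.\<close>

definition distortion_risk :: "(real \<Rightarrow> real) \<Rightarrow> 'a measure \<Rightarrow> ('a \<Rightarrow> real) \<Rightarrow> real" where
  "distortion_risk h M X = (LINT \<alpha>:{0<..1}|distortion_measure h. VaR M X \<alpha>)"

text \<open>A cdf on \<open>[0,\<infinity>)\<close> is represented by its probability law on the reals; the demand is the
  identity on that probability space.\<close>

definition demand_laws :: "real \<Rightarrow> real \<Rightarrow> real measure set" where
  "demand_laws \<mu> \<sigma> =
     {F. real_distribution F \<and> (AE s in F. 0 \<le> s) \<and>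
         has_bochner_integral F (\<lambda>s. s) \<mu> \<and>
         has_bochner_integral F (\<lambda>s. s\<^sup>2) (\<mu>\<^sup>2 + \<sigma>\<^sup>2)}"

definition newsvendor_loss :: "real \<Rightarrow> real \<Rightarrow> real \<Rightarrow> real \<Rightarrow> real" where
  "newsvendor_loss x p c s = - (p * min s x - c * x)"

definition worst_case_risk ::
  "(real \<Rightarrow> real) \<Rightarrow> real \<Rightarrow> real \<Rightarrow> real \<Rightarrow> real \<Rightarrow> real \<Rightarrow> ereal" where
  "worst_case_risk h p c \<mu> \<sigma> x =
     (SUP F \<in> demand_laws \<mu> \<sigma>. ereal (distortion_risk h F (newsvendor_loss x p c)))"

text \<open>The optimal value. That the infimum is a minimum is part of the notion of an optimal order
  quantity.\<close>

definition rho_wc ::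
  "(real \<Rightarrow> real) \<Rightarrow> real \<Rightarrow> real \<Rightarrow> real \<Rightarrow> real \<Rightarrow> ereal" where
  "rho_wc h p c \<mu> \<sigma> = (INF x \<in> {0..}. worst_case_risk h p c \<mu> \<sigma> x)"

definition optimal_order ::
  "(real \<Rightarrow> real) \<Rightarrow> real \<Rightarrow> real \<Rightarrow> real \<Rightarrow> real \<Rightarrow> real \<Rightarrow> bool" where
  "optimal_order h p c \<mu> \<sigma> x \<longleftrightarrow>
     0 \<le> x \<and> (\<forall>y\<ge>0. worst_case_risk h p c \<mu> \<sigma> x \<le> worst_case_risk h p c \<mu> \<sigma> y)"

definition worst_case_law ::
  "(real \<Rightarrow> real) \<Rightarrow> real \<Rightarrow> real \<Rightarrow> real \<Rightarrow> real \<Rightarrow> real \<Rightarrow> real measure \<Rightarrow> bool" where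
  "worst_case_law h p c \<mu> \<sigma> x F \<longleftrightarrow>
     F \<in> demand_laws \<mu> \<sigma> \<and>
     (\<forall>G \<in> demand_laws \<mu> \<sigma>.
        distortion_risk h G (newsvendor_loss x p c) \<le> distortion_risk h F (newsvendor_loss x p c))"

text \<open>The right-continuous version of the quantile function. As \<open>h'\<close> is left-continuous, a
  quantile function given by a formula in \<open>h'(1 - u)\<close> is right-continuous in \<open>u\<close>; it differs from
  the left-continuous version, which is \<open>VaR\<close> of the demand, on an at most countable set.\<close>

definition quantile :: "real measure \<Rightarrow> real \<Rightarrow> real" where
  "quantile F u = Inf {x. u < cdf F x}"

definition Delta :: "(real \<Rightarrow> real) \<Rightarrow> real \<Rightarrow> real \<Rightarrow> real \<Rightarrow> real" where
  "Delta h \<beta> s t = sqrt (t * (LINT u:{s..t}|lborel. (hder h u)\<^sup>2) - (h t - \<beta>)\<^sup>2)"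

definition sigma_t :: "real \<Rightarrow> real \<Rightarrow> real \<Rightarrow> real" where
  "sigma_t \<mu> \<sigma> t = sqrt (t * (\<mu>\<^sup>2 + \<sigma>\<^sup>2) - \<mu>\<^sup>2)"

text \<open>The candidate worst-case demand \<open>G(u) = F\<inverse>(1 - u)\<close>, truncated at \<open>t\<close>, is proportional to
  \<open>h'(t) - h'(u) 1\<^bsub>{u > s}\<^esub>\<close> on \<open>[0,t]\<close> when \<open>h'\<close> is continuous at \<open>t\<close>. This function integrates to
  \<open>t h'(t) - h(t) + \<beta>\<close>, and the condition below compares \<open>1 + r\<^sup>2\<close> with the ratio of its second
  moment to the square of its mean. Equivalently,
  \<open>(t (1 + r\<^sup>2) - 1) (t h'(t) - h(t) + \<beta>)\<^sup>2 \<le> (Delta h \<beta> s t)\<^sup>2\<close>, which says that the truncated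
  quantile function is nonnegative. The printed source has \<open>h'(u) - h(t) + \<beta>\<close>, integrated over
  \<open>[0,1]\<close>, in place of \<open>h'(t) - h'(u) 1\<^bsub>{u > s}\<^esub>\<close>, integrated over \<open>[0,t]\<close>, with which
  the result fails, e.g. for \<open>h(u) = u\<^sup>2\<close>, \<open>\<beta> = 1/4\<close> and \<open>r = 4/5\<close>. Likewise, the
  printed case (iii) quantile function has \<open>h(t) - (1 - \<beta>)\<close> for \<open>h(t) - \<beta>\<close>; its mean
  is then not \<open>\<mu>\<close> unless \<open>\<beta> = 1/2\<close>. When \<open>h'(1)\<close> is
  infinite, the left-hand side at \<open>t = 1\<close> is infinite, so \<open>t = 1\<close> is not admissible.\<close>

definition t_star :: "(real \<Rightarrow> real) \<Rightarrow> real \<Rightarrow> real \<Rightarrow> real \<Rightarrow> real" where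
  "t_star h \<beta> r s =
     (GREATEST t. t \<in> {1 / (1 + r\<^sup>2)..1} \<and> hderiv h t \<noteq> \<infinity> \<and>
        (1 + r\<^sup>2) * (t * hder h t - h t + \<beta>)\<^sup>2
          - (LINT u:{0..t}|lborel. (hder h t - hder h u * indicator {s<..} u)\<^sup>2) \<le> 0)"

end

theory Submission
  imports Defs
begin

text \<open>
  Write \<open>G(u) = F\<inverse>(1 - u)\<close> and \<open>\<beta> = c / p\<close>. For a continuous \<open>h\<close> the measure \<open>dh\<close> has density \<open>h'\<close>,
  and the risk of ordering \<open>x\<close> is \<open>p (\<beta> x - \<integral> min (G u) x h'(u) du)\<close>. The theorem exhibits a saddle
  point \<open>(x, F)\<close> of this functional, so no minimax theorem is needed.

  For fixed \<open>F\<close> the functional is convex in \<open>x\<close>, and \<open>x\<close> is optimal as soon as \<open>x \<le> G\<close> on \<open>[0,s]\<close>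
  and \<open>G \<le> x\<close> on \<open>(s,1]\<close>. For fixed \<open>x = M - k \<tau> / 2\<close>, adding the penalty \<open>(G - M)\<^sup>2 / (2 k)\<close> does not
  change the comparison of two laws with the same first two moments, and
  \<open>min g x h'(u) + (g - M)\<^sup>2 / (2 k)\<close> is minimal over \<open>g \<ge> 0\<close>, for every \<open>u\<close> separately, at \<open>g = M\<close> if
  \<open>u \<le> s\<close>, at \<open>g = M - k h'(u)\<close> if \<open>u > s\<close> and this is nonnegative, and at \<open>g = 0\<close> otherwise.
  The constants \<open>M\<close> and \<open>k\<close> are determined by the moments and by the point \<open>t\<close> where the profile is
  cut off; the maximality of \<open>t\<close> in its definition makes \<open>M - k h'\<close> nonpositive to the right of \<open>t\<close>.
\<close>

section \<open>The uniform distribution on the unit interval\<close>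

text \<open>The open interval leaves out 0, where \<open>hderiv\<close> is a right derivative, and
  1, where it may be infinite. On it \<open>hder h\<close> is finite, nonnegative and monotone.
  Demands are represented on this space by nonincreasing functions.\<close>

abbreviation unif :: "real measure" where
  "unif \<equiv> restrict_space lborel {0<..<1}"

lemma space_unif [simp]: "space unif = {0<..<1}"
  by (simp add: space_restrict_space)

lemma sets_unif [measurable_cong]: "sets unif = sets (restrict_space borel {0<..<1})"
  by (simp add: sets_restrict_space)

interpretation unif: prob_space unif
  by (auto simp: emeasure_restrict_space intro!: prob_spaceI)

lemma measure_unif_space [simp]: "measure unif {0<..<1} = 1"
  using unif.prob_space by simp

lemma measure_unif:
  "A \<in> sets borel \<Longrightarrow> A \<subseteq> {0<..<1} \<Longrightarrow> measure unif A = measure lborel A"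
  by (simp add: measure_restrict_space)

lemma borel_measurable_unif: "f \<in> borel_measurable borel \<Longrightarrow> f \<in> borel_measurable unif"
  by (simp add: measurable_restrict_space1)

lemma indicator_measurable_unif [measurable]:
  "A \<in> sets borel \<Longrightarrow> (indicator A :: real \<Rightarrow> real) \<in> borel_measurable unif"
  by (rule borel_measurable_unif) simp

lemma mono_on_measurable_unif:
  fixes f :: "real \<Rightarrow> real"
  shows "mono_on {0<..<1} f \<Longrightarrow> f \<in> borel_measurable unif"
  using borel_measurable_mono_on_fnc[of "{0<..<1}" f]
  by (simp add: measurable_cong_sets[OF sets_unif refl])

lemma integrable_unif_indicator:
  fixes f :: "real \<Rightarrow> real"
  assumes "integrable unif f" "A \<in> sets borel"
  shows "integrable unif (\<lambda>u. indicator A u * f u)"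
proof (rule Bochner_Integration.integrable_bound[OF assms(1)])
  show "AE u in unif. norm (indicator A u * f u) \<le> norm (f u)"
    by (rule AE_I2) (simp add: indicator_def)
  have [measurable]: "f \<in> borel_measurable unif" using assms(1) by simp
  show "(\<lambda>u. indicator A u * f u) \<in> borel_measurable unif"
    using indicator_measurable_unif[OF assms(2)] by (intro borel_measurable_times) auto
qed

lemma integrable_indicator_unif: "A \<in> sets borel \<Longrightarrow> integrable unif (indicator A :: real \<Rightarrow> real)"
  using integrable_unif_indicator[OF unif.integrable_const, of A 1] by simp

lemma LINT_unif_indicator:
  fixes a b :: real
  assumes "0 \<le> a" "a \<le> b" "b \<le> 1"
  shows "(LINT u|unif. indicator {a<..b} u) = b - a"
proof -
  have "(LINT u|unif. indicator {a<..b} u) = measure unif ({a<..b} \<inter> {0<..<1})"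
    by simp
  also have "\<dots> = measure lborel ({a<..b} \<inter> {0<..<1})"
    by (subst measure_unif) auto
  also have "\<dots> = measure lborel {a<..<b}"
    using assms AE_lborel_singleton[of b]
    by (intro measure_eq_AE) auto
  finally show ?thesis using assms by simp
qed

lemma LINT_unif_indicator_atMost:
  fixes b :: real
  assumes "0 \<le> b" "b \<le> 1"
  shows "(LINT u|unif. indicator {..b} u) = b"
proof -
  have "{..b} \<inter> space unif = {0<..b} \<inter> space unif" by auto
  with LINT_unif_indicator[of 0 b] assms show ?thesis
    by (simp only: Bochner_Integration.integral_indicator diff_zero order_refl)
qed

text \<open>Closed intervals and Lebesgue measure occur in \<open>Delta\<close> and
  \<open>t_star\<close>, half-open ones and \<open>unif\<close> in the proof. The integrands differ
  at most at \<open>a\<close>, \<open>b\<close>, 0 and 1.\<close>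

lemma LINT_unif_Icc:
  fixes f :: "real \<Rightarrow> real"
  assumes "0 \<le> a" "b \<le> 1"
    and [measurable]: "f \<in> borel_measurable unif"
  shows "(LINT u:{a..b}|lborel. f u) = (LINT u|unif. indicator {a<..b} u * f u)"
proof -
  have m: "(\<lambda>u. indicator {0<..<1} u * f u) \<in> borel_measurable lborel"
    using borel_measurable_restrict_space_iff[of "{0<..<1}" lborel f] assms(3) by simp
  have "(LINT u|unif. indicator {a<..b} u * f u)
      = (LINT u|lborel. indicator {0<..<1} u *\<^sub>R (indicator {a<..b} u * f u))"
    by (subst integral_restrict_space) auto
  also have "\<dots> = (LINT u|lborel. indicator {a<..b} u * (indicator {0<..<1} u * f u))"
    by (intro Bochner_Integration.integral_cong) auto
  also have "\<dots> = (LINT u|lborel. indicator ({a..b} - {a,b,0,1}) u * (indicator {0<..<1} u * f u))"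
  proof (rule integral_cong_AE)
    show "AE x in lborel. indicator {a<..b} x * (indicator {0<..<1} x * f x) =
              indicator ({a..b} - {a,b,0,1}) x * (indicator {0<..<1} x * f x)"
      using AE_lborel_singleton[of a] AE_lborel_singleton[of b]
            AE_lborel_singleton[of 0] AE_lborel_singleton[of 1]
      by eventually_elim (auto simp: indicator_def)
  qed (use m in measurable)
  \<comment> \<open>Measurability of \<open>f\<close> is known on the open unit interval, so the
    endpoints are restored by agreement off a countable null set, which asks for no measurability of
    the right-hand side.\<close>
  also have "\<dots> = (LINT u|lborel. indicator {a..b} u * f u)"
  proof (rule integral_discrete_difference[where X="{a,b,0,1}"])
    show "indicator ({a..b} - {a,b,0,1}) x * (indicator {0<..<1} x * f x)
      = indicator {a..b} x * f x" if "x \<in> space lborel" "x \<notin> {a,b,0,1}" for x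
      using that assms(1,2) by (auto simp: indicator_def)
  qed auto
  finally show ?thesis
    by (simp add: set_lebesgue_integral_def)
qed

lemma tendsto_at_left_Icc:
  fixes f :: "real \<Rightarrow> real"
  assumes "(f \<longlongrightarrow> l) (at t within {a..b})" "a < t" "t \<le> b"
  shows "(f \<longlongrightarrow> l) (at_left t)"
proof -
  have "(f \<longlongrightarrow> l) (at t within {a<..<t})"
    by (rule tendsto_within_subset[OF assms(1)]) (use assms in auto)
  moreover have "at t within {a<..<t} = at_left t"
    by (rule at_within_nhd[of _ "{a<..}"]) (use assms in auto)
  ultimately show ?thesis by simp
qed

lemma tendsto_at_right_Icc:
  fixes f :: "real \<Rightarrow> real"
  assumes "(f \<longlongrightarrow> l) (at t within {a..b})" "a \<le> t" "t < b"
  shows "(f \<longlongrightarrow> l) (at_right t)"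
proof -
  have "(f \<longlongrightarrow> l) (at t within {t<..<b})"
    by (rule tendsto_within_subset[OF assms(1)]) (use assms in auto)
  moreover have "at t within {t<..<b} = at_right t"
    by (rule at_within_nhd[of _ "{..<b}"]) (use assms in auto)
  ultimately show ?thesis by simp
qed

section \<open>Left derivatives of convex distortion functions\<close>

locale distortion_L2 =
  fixes h :: "real \<Rightarrow> real"
  assumes L2: "convex_distortion_L2 h"
begin

abbreviation slope :: "real \<Rightarrow> real \<Rightarrow> real" where
  "slope v u \<equiv> (h u - h v) / (u - v)"

lemma h_distortion: "convex_distortion h" and h_cont: "continuous_on {0..1} h"
  and hder_sq_set_integrable: "set_integrable lborel {0..1} (\<lambda>u. (hder h u)\<^sup>2)"
  using L2 by (simp_all only: convex_distortion_L2_def)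

lemma h_0 [simp]: "h 0 = 0" and h_1 [simp]: "h 1 = 1" and h_cvx: "convex_on {0..1} h"
  and h_mono_on: "mono_on {0..1} h"
  using h_distortion by (simp_all only: convex_distortion_def)

lemma h_mono: "0 \<le> v \<Longrightarrow> v \<le> u \<Longrightarrow> u \<le> 1 \<Longrightarrow> h v \<le> h u"
  by (rule mono_onD[OF h_mono_on]) auto

lemma h_nonneg: "0 \<le> u \<Longrightarrow> u \<le> 1 \<Longrightarrow> 0 \<le> h u"
  using h_mono[of 0 u] by simp

lemma h_le_1: "0 \<le> u \<Longrightarrow> u \<le> 1 \<Longrightarrow> h u \<le> 1"
  using h_mono[of u 1] by simp

lemma slope_mono:
  assumes "0 \<le> a" "a < b" "b < c" "c \<le> 1"
  shows "slope a b \<le> slope a c" "slope a c \<le> slope b c"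
proof -
  have n: "(h x - h y) / (x - y) = slope x y" for x y
    using minus_divide_divide[of "h x - h y" "x - y"] by simp
  show "slope a b \<le> slope a c" "slope a c \<le> slope b c"
    using convex_on_slope_le[OF h_cvx, of a c b] assms
    by (simp_all only: n atLeastAtMost_iff) simp_all
qed

text \<open>Difference quotients from the left increase towards \<open>u\<close> by convexity, so
  the limit exists in the extended reals and is their supremum. The slope bounds, and with them
  monotonicity, follow from this form.\<close>

lemma hderiv_eq_SUP:
  assumes "0 < u" "u \<le> 1"
  shows "hderiv h u = (SUP v\<in>{0..<u}. ereal (slope v u))"
proof -
  have "((\<lambda>v. ereal (slope v u)) \<longlongrightarrow> (SUP v\<in>{0..<u}. ereal (slope v u))) (at_left u)"
  proof (rule order_tendstoI)
    fix a assume "a < (SUP v\<in>{0..<u}. ereal (slope v u))"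
    then obtain v where v: "v \<in> {0..<u}" "a < ereal (slope v u)"
      by (auto simp: less_SUP_iff)
    then have "eventually (\<lambda>w. w \<in> {v<..<u}) (at_left u)"
      by (intro eventually_at_left_real) auto
    then show "eventually (\<lambda>w. a < ereal (slope w u)) (at_left u)"
    proof eventually_elim
      case (elim w)
      then have "slope v u \<le> slope w u" using v(1) assms by (intro slope_mono(2)) auto
      with v(2) show ?case by (meson ereal_less_eq(3) less_le_trans)
    qed
  next
    fix a assume a: "(SUP v\<in>{0..<u}. ereal (slope v u)) < a"
    have "eventually (\<lambda>w. w \<in> {0<..<u}) (at_left u)"
      using assms by (intro eventually_at_left_real) auto
    then show "eventually (\<lambda>w. ereal (slope w u) < a) (at_left u)"
    proof eventually_elim
      case (elim w)
      then have "ereal (slope w u) \<le> (SUP v\<in>{0..<u}. ereal (slope v u))"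
        by (intro SUP_upper) auto
      with a show ?case by (rule le_less_trans[rotated])
    qed
  qed
  then show ?thesis
    using assms unfolding hderiv_def by (simp add: tendsto_Lim)
qed

lemma slope_le_hderiv: "0 \<le> v \<Longrightarrow> v < u \<Longrightarrow> u \<le> 1 \<Longrightarrow> ereal (slope v u) \<le> hderiv h u"
  by (subst hderiv_eq_SUP) (auto intro!: SUP_upper)

text \<open>Through the long chord: the slope over (v,u) is at most that over (v,w), which is at
  most that over (u,w).\<close>

lemma hderiv_le_slope: "0 < u \<Longrightarrow> u < w \<Longrightarrow> w \<le> 1 \<Longrightarrow> hderiv h u \<le> ereal (slope u w)"
  by (subst hderiv_eq_SUP)
     (auto intro!: SUP_least order_trans[OF slope_mono(1) slope_mono(2)])

lemma hderiv_mono: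
  assumes "0 < u" "u \<le> w" "w \<le> 1"
  shows "hderiv h u \<le> hderiv h w"
proof (cases "u = w")
  case False
  then show ?thesis
    using hderiv_le_slope[of u w] slope_le_hderiv[of u w] assms by auto
qed simp

text \<open>If \<open>a\<close> is below h'(u), some chord slope from a fixed \<open>v\<close> to
  \<open>u\<close> exceeds \<open>a\<close>; by continuity of \<open>h\<close> so does the slope
  from \<open>v\<close> to nearby \<open>w\<close>, and this is at most h'(w). The argument includes
  u = 1, also with an infinite value. Monotonicity gives the upper half.\<close>

lemma hderiv_left_cont:
  assumes u: "0 < u" "u \<le> 1"
  shows "(hderiv h \<longlongrightarrow> hderiv h u) (at_left u)"
proof (rule order_tendstoI)
  fix a assume "a < hderiv h u"
  then obtain v where v: "v \<in> {0..<u}" "a < ereal (slope v u)"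
    using u by (auto simp: hderiv_eq_SUP less_SUP_iff)
  have "(h \<longlongrightarrow> h u) (at u within {0..1})"
    using h_cont u by (auto simp: continuous_on_def)
  then have hu: "(h \<longlongrightarrow> h u) (at u within {v..<u})"
    by (rule tendsto_within_subset) (use u v in auto)
  have "at u within {v..<u} = at_left u"
  proof (rule at_within_nhd[of _ "{v<..}"])
  qed (use v in auto)
  with hu have "((\<lambda>w. ereal (slope v w)) \<longlongrightarrow> ereal (slope v u)) (at_left u)"
    using v(1) by (intro tendsto_intros) auto
  from order_tendstoD(1)[OF this v(2)]
  have "eventually (\<lambda>w. a < ereal (slope v w)) (at_left u)" .
  moreover have "eventually (\<lambda>w. w \<in> {v<..<u}) (at_left u)"
    using v by (intro eventually_at_left_real) auto
  ultimately show "eventually (\<lambda>w. a < hderiv h w) (at_left u)"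
  proof eventually_elim
    case (elim w)
    then show ?case using slope_le_hderiv[of v w] v u by auto
  qed
next
  fix a assume a: "hderiv h u < a"
  have "eventually (\<lambda>w. w \<in> {0<..<u}) (at_left u)"
    using u by (intro eventually_at_left_real) auto
  then show "eventually (\<lambda>w. hderiv h w < a) (at_left u)"
  proof eventually_elim
    case (elim w)
    then show ?case using hderiv_mono[of w u] u a by auto
  qed
qed

lemma hderiv_nonneg:
  assumes "0 < u" "u \<le> 1"
  shows "0 \<le> hderiv h u"
proof -
  have "0 \<le> slope 0 u" using h_nonneg[of u] assms by simp
  then have "0 \<le> ereal (slope 0 u)" by simp
  also have "\<dots> \<le> hderiv h u" using slope_le_hderiv[of 0 u] assms by simp
  finally show ?thesis .
qed

lemma hderiv_eq_hder:
  assumes "0 < u" "u \<le> 1" "hderiv h u \<noteq> \<infinity>"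
  shows "hderiv h u = ereal (hder h u)"
  using hderiv_nonneg[OF assms(1,2)] assms(3) by (cases "hderiv h u") auto

lemma hderiv_neq_infinity: "0 < u \<Longrightarrow> u < 1 \<Longrightarrow> hderiv h u \<noteq> \<infinity>"
  using hderiv_le_slope[of u 1] by auto

lemma hderiv_finite: "0 < u \<Longrightarrow> u < 1 \<Longrightarrow> hderiv h u = ereal (hder h u)"
  using hderiv_neq_infinity by (intro hderiv_eq_hder) auto

lemma hder_nonneg:
  assumes "0 < u" "u \<le> 1"
  shows "0 \<le> hder h u"
  by (rule real_of_ereal_pos[OF hderiv_nonneg[OF assms]])

text \<open>Finiteness at \<open>w\<close> matters because \<open>real_of_ereal\<close> sends
  infinity to 0: with an infinite h'(1) the real-valued \<open>hder h\<close> drops to 0 at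
  1.\<close>

lemma hder_mono:
  assumes "0 < u" "u \<le> w" "w \<le> 1" "hderiv h w \<noteq> \<infinity>"
  shows "hder h u \<le> hder h w"
proof (rule real_of_ereal_positive_mono)
  show "0 \<le> hderiv h u" "hderiv h u \<le> hderiv h w" "hderiv h w \<noteq> \<infinity>"
    using assms hderiv_nonneg[of u] hderiv_mono[of u w] by auto
qed

lemma hder_mono': "0 < u \<Longrightarrow> u \<le> w \<Longrightarrow> w < 1 \<Longrightarrow> hder h u \<le> hder h w"
  using hderiv_neq_infinity by (intro hder_mono) auto

lemma hder_mono_on: "mono_on {0<..<1} (hder h)"
  by (auto intro!: mono_onI hder_mono')

lemma hder_measurable [measurable]: "hder h \<in> borel_measurable unif"
  by (rule mono_on_measurable_unif[OF hder_mono_on])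

lemma slope_le_hder:
  assumes "0 \<le> v" "v < u" "u \<le> 1" "hderiv h u \<noteq> \<infinity>"
  shows "slope v u \<le> hder h u"
proof -
  have "0 < u" using assms by simp
  from slope_le_hderiv[OF assms(1-3)] have "ereal (slope v u) \<le> ereal (hder h u)"
    by (simp only: hderiv_eq_hder[OF \<open>0 < u\<close> assms(3,4), symmetric])
  then show ?thesis by simp
qed

lemma hder_le_slope:
  assumes "0 < u" "u < w" "w \<le> 1"
  shows "hder h u \<le> slope u w"
proof -
  have "u < 1" using assms by simp
  from hderiv_le_slope[OF assms] have "ereal (hder h u) \<le> ereal (slope u w)"
    by (simp only: hderiv_finite[OF assms(1) \<open>u < 1\<close>, symmetric])
  then show ?thesis by simp
qed

lemma hder_left_cont:
  assumes "0 < u" "u \<le> 1" "hderiv h u \<noteq> \<infinity>"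
  shows "(hder h \<longlongrightarrow> hder h u) (at_left u)"
  by (rule lim_real_of_ereal)
     (use hderiv_left_cont[OF assms(1,2)] in \<open>simp only: hderiv_eq_hder[OF assms, symmetric]\<close>)

text \<open>As \<open>h 0 = 0\<close>, the chord from 0 to \<open>u\<close> has slope
  \<open>h u / u\<close>, which is at most h'(u). This gives positivity of \<open>A\<close>
  later.\<close>

lemma tangent_nonneg:
  assumes "0 < u" "u \<le> 1" "hderiv h u \<noteq> \<infinity>"
  shows "h u \<le> u * hder h u"
  using slope_le_hder[OF order_refl assms] assms(1) by (simp add: field_simps)

lemma hder_sq_integrable: "integrable unif (\<lambda>u. (hder h u)\<^sup>2)"
proof -
  have "set_integrable lborel {0<..<1} (\<lambda>u. (hder h u)\<^sup>2)"
  by (rule set_integrable_subset[of _ "{0..1}"]) (use hder_sq_set_integrable in auto)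
  then show ?thesis
    by (simp add: integrable_restrict_space set_integrable_def)
qed

lemma hder_integrable: "integrable unif (hder h)"
proof (rule Bochner_Integration.integrable_bound)
  show "integrable unif (\<lambda>u. 1 + (hder h u)\<^sup>2)"
    by (rule Bochner_Integration.integrable_add[OF unif.integrable_const hder_sq_integrable])
  show "AE u in unif. norm (hder h u) \<le> norm (1 + (hder h u)\<^sup>2)"
  proof (rule AE_I2)
    fix u
    have "\<bar>x\<bar> \<le> 1 + x\<^sup>2" for x :: real
      using sum_squares_bound[of 1 "\<bar>x\<bar>"] zero_le_power2[of x] by simp
    then have "\<bar>hder h u\<bar> \<le> 1 + (hder h u)\<^sup>2" .
    then show "norm (hder h u) \<le> norm (1 + (hder h u)\<^sup>2)"
      by simp
  qed
qed measurable

lemmas indicator_hder_integrable [simp] = integrable_unif_indicator[OF hder_integrable]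
  and indicator_hder_sq_integrable [simp] = integrable_unif_indicator[OF hder_sq_integrable]

section \<open>Recovering h by integrating its left derivative\<close>

lemma LINT_hder_bounds:
  assumes "0 < a" "a \<le> b" "b < 1"
  shows "hder h a * (b - a) \<le> (LINT u|unif. indicator {a<..b} u * hder h u)"
    and "(LINT u|unif. indicator {a<..b} u * hder h u) \<le> hder h b * (b - a)"
proof -
  have I: "integrable unif (\<lambda>u. indicator {a<..b} u * c)" for c :: real
    by (rule integrable_unif_indicator[OF unif.integrable_const]) simp
  have "(LINT u|unif. indicator {a<..b} u * hder h a) \<le> (LINT u|unif. indicator {a<..b} u * hder h u)"
    using assms by (intro integral_mono I indicator_hder_integrable)
                   (auto simp: indicator_def intro!: hder_mono')
  then show "hder h a * (b - a) \<le> (LINT u|unif. indicator {a<..b} u * hder h u)"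
    using LINT_unif_indicator[of a b] assms by (simp add: mult.commute)
  have "(LINT u|unif. indicator {a<..b} u * hder h u) \<le> (LINT u|unif. indicator {a<..b} u * hder h b)"
    using assms by (intro integral_mono I indicator_hder_integrable)
                   (auto simp: indicator_def intro!: hder_mono')
  then show "(LINT u|unif. indicator {a<..b} u * hder h u) \<le> hder h b * (b - a)"
    using LINT_unif_indicator[of a b] assms by (simp add: mult.commute)
qed

lemma h_diff_bounds:
  assumes "0 < a" "a \<le> b" "b < 1"
  shows "hder h a * (b - a) \<le> h b - h a" "h b - h a \<le> hder h b * (b - a)"
proof -
  consider "a = b" | "a < b" using assms by force
  then show "hder h a * (b - a) \<le> h b - h a" "h b - h a \<le> hder h b * (b - a)"
    using hder_le_slope[of a b] slope_le_hder[of a b] hderiv_neq_infinity[of b] assms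
    by (auto simp: field_simps)
qed

text \<open>The half-line makes this meaningful for every real \<open>x\<close>, so that
  \<open>cum\<close> can later be read as the cdf of the measure with density h'.\<close>

abbreviation cum :: "real \<Rightarrow> real" where
  "cum x \<equiv> (LINT u|unif. indicator {..x} u * hder h u)"

lemma cum_diff:
  assumes "a \<le> b"
  shows "cum b - cum a = (LINT u|unif. indicator {a<..b} u * hder h u)"
proof -
  have "cum b - cum a = (LINT u|unif. indicator {..b} u * hder h u - indicator {..a} u * hder h u)"
    by (rule Bochner_Integration.integral_diff[symmetric]; rule indicator_hder_integrable) auto
  also have "\<dots> = (LINT u|unif. indicator {a<..b} u * hder h u)"
    using assms by (intro Bochner_Integration.integral_cong) (auto simp: indicator_def)
  finally show ?thesis .
qed

text \<open>On a mesh of width \<open>\<delta>\<close>, \<open>cum\<close> and \<open>h\<close> have increments in the same interval of length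
  \<open>\<delta>\<close> times the increment of \<open>h'\<close>, and the latter telescope.\<close>

lemma cum_eq_h_interior:
  assumes "0 < a" "a \<le> b" "b < 1"
  shows "cum b - cum a = h b - h a"
proof -
  define D where "D x = cum x - h x" for x
  have step: "\<bar>D y - D x\<bar> \<le> (hder h y - hder h x) * (y - x)" if "0 < x" "x \<le> y" "y < 1" for x y
    using LINT_hder_bounds[OF that] h_diff_bounds[OF that] cum_diff[OF that(2)]
    unfolding D_def by (simp add: abs_le_iff algebra_simps)
  have bound: "\<bar>D b - D a\<bar> \<le> (b - a) * (hder h b - hder h a) / real n" if n: "0 < n" for n
  proof -
    define x where "x i = a + real i * ((b - a) / real n)" for i
    have xn: "x n = b" "x 0 = a" using n by (auto simp: x_def)
    have xd: "x (Suc i) - x i = (b - a) / real n" for i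
      using n by (simp add: x_def field_simps)
    have xr: "0 < x i" "x i \<le> x (Suc i)" "x (Suc i) < 1" if "i < n" for i
    proof -
      show "0 < x i" using assms by (simp add: x_def add_pos_nonneg)
      show "x i \<le> x (Suc i)" using xd[of i] assms by (metis diff_ge_0_iff_ge divide_nonneg_nonneg of_nat_0_le_iff)
      have "real (Suc i) * ((b - a) / real n) \<le> real n * ((b - a) / real n)"
        using that assms by (intro mult_right_mono) auto
      then show "x (Suc i) < 1" using n assms by (simp add: x_def)
    qed
    have "D b - D a = (\<Sum>i<n. D (x (Suc i)) - D (x i))"
      by (simp add: sum_lessThan_telescope[of "\<lambda>i. D (x i)"] xn)
    then have "\<bar>D b - D a\<bar> \<le> (\<Sum>i<n. \<bar>D (x (Suc i)) - D (x i)\<bar>)"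
      by simp
    also have "\<dots> \<le> (\<Sum>i<n. (hder h (x (Suc i)) - hder h (x i)) * ((b - a) / real n))"
      using step xr by (intro sum_mono) (metis lessThan_iff xd)
    also have "\<dots> = (hder h b - hder h a) * ((b - a) / real n)"
      by (subst sum_distrib_right[symmetric]) (simp add: sum_lessThan_telescope[of "\<lambda>i. hder h (x i)"] xn)
    finally show ?thesis by (simp add: mult.commute)
  qed
  have "(\<lambda>n. (b - a) * (hder h b - hder h a) / real n) \<longlonglongrightarrow> 0"
    by (rule lim_const_over_n)
  then have "\<bar>D b - D a\<bar> \<le> 0"
    by (rule tendsto_lowerbound) (auto intro!: eventually_mono[OF eventually_gt_at_top[of 0]] bound)
  then show ?thesis by (simp add: D_def)
qed

text \<open>Equality of increments inside (0,1) leaves a constant to be determined. Dominated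
  convergence with bound \<open>hder h\<close> and continuity of \<open>h\<close> fix it at 0 and
  extend the identity to 1.\<close>

lemma cum_eq_h:
  assumes x: "0 \<le> x" "x \<le> 1"
  shows "cum x = h x"
proof -
  have c0: "cum y = 0" if "y \<le> 0" for y
  proof -
    have "cum y = (LINT u|unif. 0)"
      using that by (intro Bochner_Integration.integral_cong) (auto simp: indicator_def)
    then show ?thesis by simp
  qed
  have int: "cum x = h x" if x: "0 < x" "x < 1" for x
  proof -
    define f where "f n = x / real (Suc n)" for n
    have f: "0 < f n" "f n \<le> x" for n using x by (auto simp: f_def field_simps)
    have f0: "f \<longlonglongrightarrow> 0" 
      unfolding f_def using LIMSEQ_Suc[OF lim_const_over_n[of x]] by simp
    have hf: "(\<lambda>n. h (f n)) \<longlonglongrightarrow> h 0"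
    proof (intro continuous_on_tendsto_compose[OF h_cont f0] always_eventually allI)
      show "f n \<in> {0..1}" for n using f[of n] x by auto
    qed auto
    have "(\<lambda>n. cum (f n)) \<longlonglongrightarrow> cum 0"
    proof (rule integral_dominated_convergence[where w="hder h"])
      show "AE u in unif. (\<lambda>i. indicator {..f i} u * hder h u) \<longlonglongrightarrow> indicator {..0} u * hder h u"
      proof (rule AE_I2)
        fix u assume "u \<in> space unif"
        then have u: "0 < u" by simp
        have "eventually (\<lambda>i. f i < u) sequentially" by (rule order_tendstoD(2)[OF f0 u])
        then have "eventually (\<lambda>i. indicator {..f i} u * hder h u = indicator {..0} u * hder h u) sequentially"
          by (rule eventually_mono) (use u in \<open>auto simp: indicator_def\<close>)
        then show "(\<lambda>i. indicator {..f i} u * hder h u) \<longlonglongrightarrow> indicator {..0} u * hder h u"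
          by (rule tendsto_eventually)
      qed
      show "AE u in unif. norm (indicator {..f i} u * hder h u) \<le> hder h u" for i
        by (rule AE_I2) (auto simp: indicator_def hder_nonneg)
    qed (auto intro!: hder_integrable)
    then have "(\<lambda>n. cum x - h x - (cum (f n) - h (f n))) \<longlonglongrightarrow> cum x - h x - (0 - 0)"
      using hf c0[of 0] by (intro tendsto_intros) auto
    moreover have "cum x - h x - (cum (f n) - h (f n)) = 0" for n
      using cum_eq_h_interior[of "f n" x] f[of n] x by simp
    ultimately show ?thesis by (simp add: LIMSEQ_const_iff)
  qed
  have "cum 1 = h 1"
  proof -
    \<comment> \<open>The shift by two makes the sequence start at 1/2, so that every term lies
      strictly inside (0,1).\<close>
    define f where "f n = 1 - 1 / real (Suc (Suc n))" for n
    have f: "0 < f n" "f n < 1" for n by (auto simp: f_def field_simps)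
    have "(\<lambda>n. 1 / real (Suc (Suc n))) \<longlonglongrightarrow> 0"
      using LIMSEQ_Suc[OF LIMSEQ_Suc[OF lim_const_over_n[of 1]]] by simp
    then have f1: "f \<longlonglongrightarrow> 1"
      unfolding f_def using tendsto_diff[OF tendsto_const[of 1]] by fastforce
    have hf: "(\<lambda>n. h (f n)) \<longlonglongrightarrow> h 1"
      using f by (intro continuous_on_tendsto_compose[OF h_cont f1])
        (auto intro!: always_eventually less_imp_le)
    have "(\<lambda>n. cum (f n)) \<longlonglongrightarrow> cum 1"
    proof (rule integral_dominated_convergence[where w="hder h"])
      show "AE u in unif. (\<lambda>i. indicator {..f i} u * hder h u) \<longlonglongrightarrow> indicator {..1} u * hder h u"
      proof (rule AE_I2)
        fix u assume "u \<in> space unif"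
        then have u: "u < 1" by simp
        have "eventually (\<lambda>i. u < f i) sequentially" by (rule order_tendstoD(1)[OF f1 u])
        then have "eventually (\<lambda>i. indicator {..f i} u * hder h u = indicator {..1} u * hder h u) sequentially"
          by (rule eventually_mono) (use u in \<open>auto simp: indicator_def\<close>)
        then show "(\<lambda>i. indicator {..f i} u * hder h u) \<longlonglongrightarrow> indicator {..1} u * hder h u"
          by (rule tendsto_eventually)
      qed
      show "AE u in unif. norm (indicator {..f i} u * hder h u) \<le> hder h u" for i
        by (rule AE_I2) (auto simp: indicator_def hder_nonneg)
    qed (auto intro!: hder_integrable)
    then show ?thesis using hf int f by (simp add: LIMSEQ_unique)
  qed
  with c0[of 0] int x show ?thesis
    by (metis h_0 less_eq_real_def)
qed

lemma LINT_hder: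
  assumes "0 \<le> a" "a \<le> b" "b \<le> 1"
  shows "(LINT u|unif. indicator {a<..b} u * hder h u) = h b - h a"
  using cum_diff[of a b] assms by (simp add: cum_eq_h)

end

section \<open>Quantile functions and the distortion risk\<close>

lemma cdf_distribution_of: "real_distribution F \<Longrightarrow> cdf_distribution F"
  by (simp add: cdf_distribution_def)

context real_distribution
begin

text \<open>The Galois connection of the right-continuous quantile function: the strict inequality
  in its definition turns into the left limit of the cdf, the mass of \<open>{..<z}\<close>.
  Quantiles are computed below by comparing their lower bounds \<open>z\<close>.\<close>

lemma le_quantile_iff:
  assumes w: "0 < w" "w < 1"
  shows "z \<le> quantile M w \<longleftrightarrow> measure M {..<z} \<le> w"
proof
  have ne: "{x. w < cdf M x} \<noteq> {}"
    using eventually_happens'[OF _ order_tendstoD(1)[OF cdf_lim_at_top_prob w(2)]] by auto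
  obtain y where y: "cdf M y < w"
    using eventually_happens'[OF _ order_tendstoD(2)[OF cdf_lim_at_bot w(1)]] by auto
  have bdd: "bdd_below {x. w < cdf M x}"
  proof (rule bdd_belowI)
    fix x assume "x \<in> {x. w < cdf M x}"
    then show "y \<le> x" using cdf_nondecreasing[of x y] y by (cases "y \<le> x") auto
  qed
  {
    assume z: "z \<le> quantile M w"
    have "eventually (\<lambda>x. cdf M x \<le> w) (at_left z)"
    proof (rule eventually_mono[OF eventually_at_left_real[of "z - 1" z]])
      fix x assume x: "x \<in> {z - 1<..<z}"
      show "cdf M x \<le> w"
      proof (rule ccontr)
        assume "\<not> cdf M x \<le> w"
        then have "quantile M w \<le> x"
          unfolding quantile_def by (intro cInf_lower bdd) auto
        then show False using x z by simp
      qed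
    qed simp
    then show "measure M {..<z} \<le> w"
      by (intro tendsto_upperbound[OF cdf_at_left]) auto
  next
    assume z: "measure M {..<z} \<le> w"
    show "z \<le> quantile M w"
      unfolding quantile_def
    proof (rule cInf_greatest[OF ne])
      fix x assume x: "x \<in> {x. w < cdf M x}"
      show "z \<le> x"
      proof (rule ccontr)
        assume "\<not> z \<le> x"
        then have "cdf M x \<le> measure M {..<z}"
          unfolding cdf_def by (intro finite_measure_mono) auto
        then show False using x z by simp
      qed
    qed
  }
qed

lemma quantile_mono:
  assumes "0 < v" "v \<le> w" "w < 1"
  shows "quantile M v \<le> quantile M w"
  using le_quantile_iff[of v "quantile M v"] le_quantile_iff[of w "quantile M v"] assms by simp

lemma quantile_measurable [measurable]: "(\<lambda>u. quantile M (1 - u)) \<in> borel_measurable unif"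
proof -
  have "(\<lambda>u. - quantile M (1 - u)) \<in> borel_measurable unif"
    by (rule mono_on_measurable_unif) (auto intro!: mono_onI quantile_mono)
  from borel_measurable_uminus[OF this] show ?thesis by simp
qed

text \<open>Reflection exchanges the two versions of the quantile function:
  \<open>quantile M (1 - u)\<close> is minus the left-continuous pseudo-inverse, at
  \<open>u\<close>, of the law of the negated variable. That pseudo-inverse maps the uniform
  distribution to the reflected law, and a second reflection gives \<open>M\<close>.\<close>

lemma distr_quantile: "distr unif borel (\<lambda>u. quantile M (1 - u)) = M"
proof -
  define N where "N = distr M borel uminus"
  have N: "real_distribution N"
    unfolding N_def by (rule real_distribution_distr) simp
  interpret N: cdf_distribution N
    by (rule cdf_distribution_of[OF N])
  have eq: "quantile M (1 - u) = - N.I u" if u: "u \<in> {0<..<1}" for u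
  proof -
    have "z \<le> quantile M (1 - u) \<longleftrightarrow> z \<le> - N.I u" for z
    proof -
      have "measure M {..<z} = 1 - measure M {z..}"
        using prob_compl[of "{z..}"] by (simp add: Compl_eq_Diff_UNIV[symmetric] not_le Compl_atLeast)
      moreover have "cdf N (- z) = measure M {z..}"
        unfolding cdf_def N_def by (subst measure_distr) (auto intro!: arg_cong[where f = "measure M"])
      ultimately have "measure M {..<z} \<le> 1 - u \<longleftrightarrow> u \<le> cdf N (- z)" by auto
      also have "\<dots> \<longleftrightarrow> N.I u \<le> - z" using N.pseudoinverse[of u "- z"] u by auto
      finally show ?thesis using le_quantile_iff[of "1 - u" z] u by auto
    qed
    from this[of "- N.I u"] this[of "quantile M (1 - u)"] show ?thesis by auto
  qed
  have mI: "N.I \<in> borel_measurable unif"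
    by (rule mono_on_measurable_unif[OF N.mono_I])
  have "distr unif borel (\<lambda>u. quantile M (1 - u)) = distr unif borel (uminus \<circ> N.I)"
    by (rule distr_cong) (simp_all add: eq)
  also have "\<dots> = distr (distr unif borel N.I) borel uminus"
    by (rule distr_distr[symmetric]) (use mI in auto)
  also have "\<dots> = distr (distr M borel uminus) borel uminus"
    by (simp only: N.distr_I_eq_M) (simp only: N_def)
  also have "\<dots> = distr M M id"
    by (subst distr_distr) (auto intro!: distr_cong)
  finally show ?thesis by (simp add: id_def)
qed

lemma integrable_quantile_iff:
  fixes g :: "real \<Rightarrow> real"
  assumes "g \<in> borel_measurable borel"
  shows "integrable unif (\<lambda>u. g (quantile M (1 - u))) \<longleftrightarrow> integrable M g"
  using integrable_distr_eq[OF quantile_measurable assms] by (simp add: distr_quantile)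

lemma LINT_quantile:
  fixes g :: "real \<Rightarrow> real"
  assumes "g \<in> borel_measurable borel"
  shows "(LINT u|unif. g (quantile M (1 - u))) = (LINT x|M. g x)"
  using integral_distr[OF quantile_measurable assms] by (simp add: distr_quantile)

lemma quantile_nonneg:
  assumes "AE x in M. 0 \<le> x" "0 < w" "w < 1"
  shows "0 \<le> quantile M w"
proof -
  have "measure M {..<0} = 0"
    by (rule AE_iff_measurable[THEN iffD1, THEN measure_eq_emeasure_eq_ennreal[of 0, simplified]])
       (use assms(1) in \<open>auto simp: not_le\<close>)
  then show ?thesis
    using le_quantile_iff[of w 0] assms by simp
qed

text \<open>The loss is nonincreasing in the demand, so its left-continuous quantile at \<alpha> is
  obtained from the right-continuous demand quantile at 1 - \<alpha>.\<close>

lemma VaR_newsvendor_loss: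
  assumes "0 < p" "0 < \<alpha>" "\<alpha> < 1"
  shows "VaR M (newsvendor_loss x p c) \<alpha> = c * x - p * min (quantile M (1 - \<alpha>)) x"
proof -
  have "\<alpha> \<le> measure M {w \<in> space M. newsvendor_loss x p c w \<le> y}
      \<longleftrightarrow> c * x - p * min (quantile M (1 - \<alpha>)) x \<le> y" for y
  proof -
    \<comment> \<open>\<open>z\<close> is the least amount of sales that keeps the loss at or below
      \<open>y\<close>; sales never exceed \<open>x\<close>, so no demand qualifies if z >
      x.\<close>
    define z where "z = (c * x - y) / p"
    have le: "c * x - p * v \<le> y \<longleftrightarrow> z \<le> v" for v
      using assms(1) by (simp add: z_def field_simps)
    have set: "{w \<in> space M. newsvendor_loss x p c w \<le> y} = (if z \<le> x then {z..} else {})"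
      using le by (auto simp: newsvendor_loss_def)
    have "measure M {..<z} = 1 - measure M {z..}"
      using prob_compl[of "{z..}"] by (simp add: Compl_eq_Diff_UNIV[symmetric] not_le Compl_atLeast)
    then show ?thesis
      unfolding set le using le_quantile_iff[of "1 - \<alpha>" z] assms by auto
  qed
  then have "VaR M (newsvendor_loss x p c) \<alpha> = Inf {c * x - p * min (quantile M (1 - \<alpha>)) x..}"
    unfolding VaR_def by (simp add: atLeast_def)
  then show ?thesis by simp
qed

end

section \<open>Laws with a prescribed nonincreasing quantile function\<close>

lemma antimono_measurable_unif:
  fixes G :: "real \<Rightarrow> real"
  assumes "antimono_on {0<..<1} G"
  shows "G \<in> borel_measurable unif"
proof -
  have "(\<lambda>u. - G u) \<in> borel_measurable unif"
    by (rule mono_on_measurable_unif) (use assms in \<open>auto intro!: mono_onI dest: monotone_onD\<close>)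
  from borel_measurable_uminus[OF this] show ?thesis by simp
qed

text \<open>For nonincreasing \<open>G\<close> the set where \<open>G\<close> is below
  \<open>z\<close> is an interval ending at 1, so its measure tells whether \<open>u\<close> lies in
  it. Left-continuity settles the endpoint: if \<open>G u\<close> is below \<open>z\<close>, so is
  \<open>G a\<close> for some a < u, and the measure exceeds 1 - u.\<close>

lemma quantile_distr_unif:
  fixes G :: "real \<Rightarrow> real"
  assumes anti: "antimono_on {0<..<1} G"
    and left: "\<And>u. u \<in> {0<..<1} \<Longrightarrow> (G \<longlongrightarrow> G u) (at_left u)"
    and u: "u \<in> {0<..<1}"
  shows "quantile (distr unif borel G) (1 - u) = G u"
proof -
  note [measurable] = antimono_measurable_unif[OF anti]
  interpret F: real_distribution "distr unif borel G"
    by (rule unif.real_distribution_distr) simp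
  have "z \<le> quantile (distr unif borel G) (1 - u) \<longleftrightarrow> z \<le> G u" for z
  proof -
    have m: "measure (distr unif borel G) {..<z} = measure unif {v \<in> space unif. G v < z}"
      by (subst measure_distr) (auto intro!: arg_cong[where f = "measure unif"])
    have meas: "{v \<in> space unif. G v < z} \<in> sets unif" by measurable
    have sub: "{a<..<1} \<in> sets unif" "measure unif {a<..<1} = 1 - a" if "0 < a" "a < 1" for a
    proof -
      have "{a<..<1} \<subseteq> {0<..<1}" using that by auto
      then show "{a<..<1} \<in> sets unif" "measure unif {a<..<1} = 1 - a"
        using that by (auto simp: sets_restrict_space measure_unif)
    qed
    have "measure unif {v \<in> space unif. G v < z} \<le> 1 - u \<longleftrightarrow> z \<le> G u"
    proof
      assume z: "z \<le> G u"
      have "{v \<in> space unif. G v < z} \<subseteq> {u<..<1}"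
      proof safe
        fix v assume v: "v \<in> space unif" "G v < z"
        have "\<not> v \<le> u"
        proof
          assume "v \<le> u"
          then have "G u \<le> G v" using monotone_onD[OF anti, of v u] v u by auto
          then show False using v z by simp
        qed
        then show "v \<in> {u<..<1}" using v by auto
      qed
      then have "measure unif {v \<in> space unif. G v < z} \<le> measure unif {u<..<1}"
        using sub(1)[of u] u by (intro unif.finite_measure_mono) auto
      then show "measure unif {v \<in> space unif. G v < z} \<le> 1 - u"
        using sub(2)[of u] u by simp
    next
      assume le: "measure unif {v \<in> space unif. G v < z} \<le> 1 - u"
      show "z \<le> G u"
      proof (rule ccontr)
        assume "\<not> z \<le> G u"
        then have "eventually (\<lambda>v. G v < z) (at_left u)"
          using order_tendstoD(2)[OF left[OF u]] by simp
        moreover have "eventually (\<lambda>v. v \<in> {0<..<u}) (at_left u)"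
          using u by (intro eventually_at_left_real) auto
        ultimately have "eventually (\<lambda>v. G v < z \<and> v \<in> {0<..<u}) (at_left u)"
          by eventually_elim auto
        then obtain a where a: "G a < z" "0 < a" "a < u"
          using eventually_happens'[OF trivial_limit_at_left_real] by fastforce
        have "{a<..<1} \<subseteq> {v \<in> space unif. G v < z}"
        proof
          fix v assume v: "v \<in> {a<..<1}"
          then have "G v \<le> G a" using monotone_onD[OF anti, of a v] a u by auto
          then show "v \<in> {v \<in> space unif. G v < z}" using v a by auto
        qed
        then have "measure unif {a<..<1} \<le> measure unif {v \<in> space unif. G v < z}"
          by (rule unif.finite_measure_mono[OF _ meas])
        then show False using le sub(2)[of a] a u by simp
      qed
    qed
    then show ?thesis
      using F.le_quantile_iff[of "1 - u" z] u m by auto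
  qed
  from this[of "G u"] this[of "quantile (distr unif borel G) (1 - u)"] show ?thesis by auto
qed

lemma distr_unif_demand_law:
  fixes G :: "real \<Rightarrow> real"
  assumes [measurable]: "G \<in> borel_measurable unif"
    and "\<And>u. u \<in> {0<..<1} \<Longrightarrow> 0 \<le> G u"
    and "integrable unif G" "integrable unif (\<lambda>u. (G u)\<^sup>2)"
    and "(LINT u|unif. G u) = \<mu>" "(LINT u|unif. (G u)\<^sup>2) = \<mu>\<^sup>2 + \<sigma>\<^sup>2"
  shows "distr unif borel G \<in> demand_laws \<mu> \<sigma>"
  unfolding demand_laws_def using assms
  by (auto simp: has_bochner_integral_iff integrable_distr_eq integral_distr AE_distr_iff
      intro!: unif.real_distribution_distr AE_I2)

section \<open>The distortion risk as an integral against h'\<close>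

context distortion_L2
begin

text \<open>Two probability measures with the same cdf agree. The cdf of the density is
  \<open>cum\<close>, which is \<open>h\<close> on [0,1]; the other cdf is \<open>h\<close> extended
  by constants, and continuity of \<open>h\<close> at 1 rules out an atom there.\<close>

lemma distortion_measure_eq:
  "distortion_measure h = density lborel (\<lambda>u. ennreal (indicator {0<..<1} u * hder h u))"
proof -
  define H where "H u = (if u < 0 then 0 else if 1 < u then 1 else h u)" for u
  have H: "H u = (if u \<le> 0 then 0 else if 1 \<le> u then 1 else h u)" for u
    by (auto simp: H_def)
  have mono: "H v \<le> H u" if "v \<le> u" for v u
    using that h_nonneg[of v] h_nonneg[of u] h_le_1[of v] h_le_1[of u] h_mono[of v u]
    by (auto simp: H_def)
  have "continuous_on UNIV H"
  proof -
    \<comment> \<open>Clamping the argument to [0,1] and using the boundary values of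
      \<open>h\<close> gives continuity on the whole line.\<close>
    have eq: "H u = h (max 0 (min 1 u))" for u
      by (auto simp: H)
    have "continuous_on UNIV (\<lambda>u. h (max 0 (min 1 u)))"
      by (rule continuous_on_compose2[OF h_cont]) (auto intro!: continuous_intros)
    then show ?thesis by (simp add: eq[abs_def])
  qed
  then have cont: "continuous (at_right a) H" for a
    by (metis UNIV_I continuous_on_eq_continuous_within continuous_within_subset subset_UNIV)
  have bot: "(H \<longlongrightarrow> 0) at_bot"
    by (rule tendsto_eventually) (auto simp: H intro: eventually_mono[OF eventually_le_at_bot[of 0]])
  have top: "(H \<longlongrightarrow> 1) at_top"
    by (rule tendsto_eventually)
       (auto simp: H split: if_splits intro!: eventually_mono[OF eventually_ge_at_top[of 1]])
  have RH: "real_distribution (interval_measure H)"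
    by (rule real_distribution_interval_measure[OF mono cont bot top])
  define D where "D = density lborel (\<lambda>u. ennreal (indicator {0<..<1} u * hder h u))"
  have m: "(\<lambda>u. indicator {0<..<1} u * hder h u) \<in> borel_measurable borel"
    using borel_measurable_restrict_space_iff[of "{0<..<1}" lborel "hder h"] hder_measurable by simp
  have em: "emeasure D A = ennreal (LINT u|unif. indicator A u * hder h u)" if "A \<in> sets borel" for A
  proof -
    have "emeasure D A = (\<integral>\<^sup>+u. ennreal (indicator {0<..<1} u * (indicator A u * hder h u)) \<partial>lborel)"
      unfolding D_def using that m
      by (subst emeasure_density) (auto intro!: nn_integral_cong simp: indicator_def)
    also have "\<dots> = ennreal (LINT u|lborel. indicator {0<..<1} u * (indicator A u * hder h u))"
    proof (rule nn_integral_eq_integral)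
      show "integrable lborel (\<lambda>u. indicator {0<..<1} u * (indicator A u * hder h u))"
        using indicator_hder_integrable[OF that] by (simp add: integrable_restrict_space)
    qed (auto simp: indicator_def hder_nonneg)
    also have "\<dots> = ennreal (LINT u|unif. indicator A u * hder h u)"
      by (subst integral_restrict_space) auto
    finally show ?thesis .
  qed
  have nn: "0 \<le> (LINT u|unif. indicator A u * hder h u)" for A
    by (rule integral_nonneg_AE, rule AE_I2) (auto simp: indicator_def hder_nonneg)
  have cumH: "cum x = H x" for x
  proof -
    consider "x < 0" | "0 \<le> x" "x \<le> 1" | "1 < x" by linarith
    then show ?thesis
    proof cases
      case 1
      then have "cum x = (LINT u|unif. 0)"
        by (intro Bochner_Integration.integral_cong) (auto simp: indicator_def)
      then show ?thesis using 1 by (simp add: H)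
    next
      case 2
      then show ?thesis by (simp add: cum_eq_h H_def)
    next
      case 3
      then have "cum x = cum 1"
        by (intro Bochner_Integration.integral_cong) (auto simp: indicator_def)
      then show ?thesis using 3 by (simp add: H cum_eq_h)
    qed
  qed
  have RD: "real_distribution D"
  proof -
    have "emeasure D UNIV = ennreal (cum 1)"
      by (subst em) (auto intro!: arg_cong[where f = ennreal] Bochner_Integration.integral_cong simp: indicator_def)
    then have "prob_space D"
      by (intro prob_spaceI) (simp add: cumH H D_def)
    then show ?thesis
      by (simp add: real_distribution_def real_distribution_axioms_def D_def)
  qed
  have "cdf D = H"
    using em[of "{.._}"] nn by (auto simp: cdf_def measure_def cumH[symmetric])
  with cdf_interval_measure[OF mono cont bot]
  have "interval_measure H = D"
    by (intro cdf_unique[OF RH RD]) simp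
  then show ?thesis
    by (simp add: distortion_measure_def D_def H_def[abs_def])
qed

lemma min_hder_integrable:
  fixes G :: "real \<Rightarrow> real"
  assumes [measurable]: "G \<in> borel_measurable unif"
    and G: "\<And>u. u \<in> {0<..<1} \<Longrightarrow> 0 \<le> G u" and x: "0 \<le> x"
  shows "integrable unif (\<lambda>u. min (G u) x * hder h u)"
proof (rule Bochner_Integration.integrable_bound)
  show "integrable unif (\<lambda>u. x * hder h u)"
    using hder_integrable by simp
  show "AE u in unif. norm (min (G u) x * hder h u) \<le> norm (x * hder h u)"
  proof (rule AE_I2)
    fix u assume "u \<in> space unif"
    then have "0 \<le> hder h u" "0 \<le> G u" using hder_nonneg G by auto
    then show "norm (min (G u) x * hder h u) \<le> norm (x * hder h u)"
      using x by (simp add: mult_right_mono)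
  qed
qed measurable

text \<open>Levels in (0,1) suffice since the density vanishes elsewhere; \<open>c * x\<close> comes
  out unchanged because h' has total mass \<open>h 1 = 1\<close>.\<close>

lemma distortion_risk_newsvendor:
  assumes F: "real_distribution F" "AE s in F. 0 \<le> s" and "0 < p" "0 \<le> x"
  shows "distortion_risk h F (newsvendor_loss x p c)
    = c * x - p * (LINT u|unif. min (quantile F (1 - u)) x * hder h u)"
proof -
  interpret F: real_distribution F by fact
  define V where "V u = c * x - p * min (quantile F (1 - u)) x" for u
  have Vm [measurable]: "V \<in> borel_measurable unif"
    unfolding V_def by measurable
  have Vb: "(\<lambda>u. indicator {0<..<1} u * V u) \<in> borel_measurable borel"
    using borel_measurable_restrict_space_iff[of "{0<..<1}" lborel V] Vm by simp
  have hb: "(\<lambda>u. indicator {0<..<1} u * hder h u) \<in> borel_measurable borel"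
    using borel_measurable_restrict_space_iff[of "{0<..<1}" lborel "hder h"] hder_measurable by simp
  \<comment> \<open>Level 1 is not covered by the formula for \<open>VaR\<close>; changing one point
    preserves measurability.\<close>
  have m: "(\<lambda>u. indicator {0<..1} u * VaR F (newsvendor_loss x p c) u) \<in> borel_measurable borel"
    by (rule measurable_discrete_difference[OF Vb, of "{1}"])
       (auto simp: indicator_def V_def F.VaR_newsvendor_loss[OF assms(3)])
  have int: "integrable unif (\<lambda>u. min (quantile F (1 - u)) x * hder h u)"
    using F.quantile_nonneg[OF F(2)] assms(4) by (intro min_hder_integrable) auto
  have "distortion_risk h F (newsvendor_loss x p c)
    = (LINT u|lborel. indicator {0<..<1} u * hder h u * (indicator {0<..1} u * VaR F (newsvendor_loss x p c) u))"
    unfolding distortion_risk_def set_lebesgue_integral_def distortion_measure_eq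
    by (subst integral_density) (use m hb in \<open>auto simp: indicator_def hder_nonneg\<close>)
  also have "\<dots> = (LINT u|lborel. indicator {0<..<1} u *\<^sub>R (V u * hder h u))"
    by (rule Bochner_Integration.integral_cong)
       (auto simp: indicator_def V_def F.VaR_newsvendor_loss[OF assms(3)])
  also have "\<dots> = (LINT u|unif. V u * hder h u)"
    by (subst integral_restrict_space) auto
  also have "\<dots> = (LINT u|unif. c * x * hder h u - p * (min (quantile F (1 - u)) x * hder h u))"
    by (simp add: V_def algebra_simps)
  also have "\<dots> = c * x * (LINT u|unif. hder h u) - p * (LINT u|unif. min (quantile F (1 - u)) x * hder h u)"
    using hder_integrable int by simp
  also have "(LINT u|unif. hder h u) = cum 1"
    by (rule Bochner_Integration.integral_cong) (auto simp: indicator_def)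
  finally show ?thesis by (simp add: cum_eq_h)
qed

end

section \<open>Saddle points\<close>

text \<open>At \<open>x\<close> the supremum over laws is attained at \<open>F\<close>, and at any
  other order it is at least the risk under \<open>F\<close>, which \<open>order\<close> bounds from
  below by the same value. The infimum is therefore attained at \<open>x\<close>.\<close>

lemma saddle_point_optimal:
  assumes "F \<in> demand_laws \<mu> \<sigma>" "0 \<le> x"
    and order: "\<And>y. 0 \<le> y \<Longrightarrow>
      distortion_risk h F (newsvendor_loss x p c) \<le> distortion_risk h F (newsvendor_loss y p c)"
    and law: "\<And>G. G \<in> demand_laws \<mu> \<sigma> \<Longrightarrow>
      distortion_risk h G (newsvendor_loss x p c) \<le> distortion_risk h F (newsvendor_loss x p c)"
  shows "rho_wc h p c \<mu> \<sigma> = ereal (distortion_risk h F (newsvendor_loss x p c))"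
    and "optimal_order h p c \<mu> \<sigma> x" and "worst_case_law h p c \<mu> \<sigma> x F"
proof -
  have x: "worst_case_risk h p c \<mu> \<sigma> x = ereal (distortion_risk h F (newsvendor_loss x p c))"
    unfolding worst_case_risk_def
    by (intro antisym SUP_least) (use law assms(1) in \<open>auto intro: SUP_upper2\<close>)
  have y: "worst_case_risk h p c \<mu> \<sigma> x \<le> worst_case_risk h p c \<mu> \<sigma> y" if "0 \<le> y" for y
    unfolding x unfolding worst_case_risk_def
    by (rule SUP_upper2[OF assms(1)]) (use order[OF that] in simp)
  show "rho_wc h p c \<mu> \<sigma> = ereal (distortion_risk h F (newsvendor_loss x p c))"
    unfolding rho_wc_def x[symmetric]
    by (intro antisym INF_greatest) (use y assms(2) in \<open>auto intro: INF_lower\<close>)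
  show "optimal_order h p c \<mu> \<sigma> x"
    using y assms(2) by (simp add: optimal_order_def)
  show "worst_case_law h p c \<mu> \<sigma> x F"
    using law assms(1) by (simp add: worst_case_law_def)
qed

lemma demand_law_quantile:
  assumes F: "F \<in> demand_laws \<mu> \<sigma>"
  shows "real_distribution F" "AE s in F. 0 \<le> s"
    and "(\<lambda>u. quantile F (1 - u)) \<in> borel_measurable unif"
    and "u \<in> {0<..<1} \<Longrightarrow> 0 \<le> quantile F (1 - u)"
    and "integrable unif (\<lambda>u. quantile F (1 - u))"
    and "integrable unif (\<lambda>u. (quantile F (1 - u))\<^sup>2)"
    and "(LINT u|unif. quantile F (1 - u)) = \<mu>"
    and "(LINT u|unif. (quantile F (1 - u))\<^sup>2) = \<mu>\<^sup>2 + \<sigma>\<^sup>2"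
proof -
  show RF: "real_distribution F" and ae: "AE s in F. 0 \<le> s"
    using F by (auto simp: demand_laws_def)
  interpret real_distribution F by fact
  show "(\<lambda>u. quantile F (1 - u)) \<in> borel_measurable unif"
    by (rule quantile_measurable)
  show "u \<in> {0<..<1} \<Longrightarrow> 0 \<le> quantile F (1 - u)"
    using ae by (intro quantile_nonneg) auto
  show "integrable unif (\<lambda>u. quantile F (1 - u))" "integrable unif (\<lambda>u. (quantile F (1 - u))\<^sup>2)"
    "(LINT u|unif. quantile F (1 - u)) = \<mu>"
    "(LINT u|unif. (quantile F (1 - u))\<^sup>2) = \<mu>\<^sup>2 + \<sigma>\<^sup>2"
    using F integrable_quantile_iff[of "\<lambda>x. x"] integrable_quantile_iff[of "\<lambda>x. x\<^sup>2"]
      LINT_quantile[of "\<lambda>x. x"] LINT_quantile[of "\<lambda>x. x\<^sup>2"]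
    by (auto simp: demand_laws_def has_bochner_integral_iff)
qed

lemma LINT_sq_diff:
  fixes G :: "real \<Rightarrow> real"
  assumes "integrable unif G" "integrable unif (\<lambda>u. (G u)\<^sup>2)"
  shows "integrable unif (\<lambda>u. (G u - m)\<^sup>2)"
    and "(LINT u|unif. (G u - m)\<^sup>2) = (LINT u|unif. (G u)\<^sup>2) - 2 * m * (LINT u|unif. G u) + m\<^sup>2"
proof -
  have eq: "(\<lambda>u. (G u - m)\<^sup>2) = (\<lambda>u. (G u)\<^sup>2 - 2 * m * G u + m\<^sup>2)"
    by (simp add: power2_diff algebra_simps)
  show "integrable unif (\<lambda>u. (G u - m)\<^sup>2)"
    unfolding eq using assms by auto
  show "(LINT u|unif. (G u - m)\<^sup>2) = (LINT u|unif. (G u)\<^sup>2) - 2 * m * (LINT u|unif. G u) + m\<^sup>2"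
    unfolding eq using assms by simp
qed

lemma zero_variance_AE:
  fixes G :: "real \<Rightarrow> real"
  assumes "integrable unif G" "integrable unif (\<lambda>u. (G u)\<^sup>2)"
    and "(LINT u|unif. G u) = m" "(LINT u|unif. (G u)\<^sup>2) = m\<^sup>2"
  shows "AE u in unif. G u = m"
proof -
  have "(LINT u|unif. (G u - m)\<^sup>2) = 0"
    unfolding LINT_sq_diff(2)[OF assms(1,2)] assms(3,4) by (simp add: power2_eq_square)
  then have "AE u in unif. (G u - m)\<^sup>2 = 0"
    using integral_nonneg_eq_0_iff_AE[OF LINT_sq_diff(1)[OF assms(1,2)]] by simp
  then show ?thesis by eventually_elim simp
qed

section \<open>Pointwise minimization of the penalized sales\<close>

context
  fixes k M \<tau> d x g :: real
  assumes k: "0 < k" and x: "x = M - k * \<tau> / 2" and tau: "0 \<le> \<tau>"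
begin

text \<open>Without the cap \<open>x\<close> the integrand is a parabola in \<open>g\<close> with
  vertex at \<open>M - k * d\<close>; the left-hand side is its minimum.\<close>

lemma complete_square: "M * d - k * d\<^sup>2 / 2 \<le> g * d + (g - M)\<^sup>2 / (2 * k)"
proof -
  have "g * d + (g - M)\<^sup>2 / (2 * k) - (M * d - k * d\<^sup>2 / 2) = (g - M + k * d)\<^sup>2 / (2 * k)"
    using k by (simp add: field_simps power2_eq_square)
  then show ?thesis
    using k by (metis diff_ge_0_iff_ge divide_nonneg_nonneg mult_nonneg_nonneg less_imp_le zero_le_numeral zero_le_power2)
qed

text \<open>The vertex \<open>M - k * d\<close> lies below \<open>x\<close>, so the minimum of the
  parabola is attained there. For \<open>g\<close> above \<open>x\<close> the integrand is at least
  \<open>x * d\<close>. The factor 1/2 in \<open>x\<close> makes \<open>x * d\<close> equal to that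
  minimum at d = \<tau>, and for larger \<open>d\<close> it is not smaller.\<close>

lemma penalized_min_low:
  assumes "\<tau> \<le> d"
  shows "min (M - k * d) x * d + (M - k * d - M)\<^sup>2 / (2 * k) \<le> min g x * d + (g - M)\<^sup>2 / (2 * k)"
proof -
  have "k * \<tau> \<le> k * d" "0 \<le> k * \<tau>" using assms k tau by auto
  then have "M - k * d \<le> x" unfolding x by linarith
  then have L: "min (M - k * d) x * d + (M - k * d - M)\<^sup>2 / (2 * k) = M * d - k * d\<^sup>2 / 2"
    using k by (simp add: field_simps power2_eq_square)
  show ?thesis
  proof (cases "g \<le> x")
    case True
    then show ?thesis using complete_square L by simp
  next
    case False
    have "k * \<tau> * d \<le> k * d * d"
      using assms k tau by (intro mult_right_mono) auto
    then have "M * d - k * d\<^sup>2 / 2 \<le> x * d"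
      unfolding x by (simp add: algebra_simps power2_eq_square)
    also have "\<dots> \<le> min g x * d + (g - M)\<^sup>2 / (2 * k)"
      using False k by simp
    finally show ?thesis using L by simp
  qed
qed

text \<open>The comparison is reversed: for d \<le> \<tau> the capped value \<open>x * d\<close>,
  attained with zero penalty at g = M, is at most the minimum of the parabola.\<close>

lemma penalized_min_high:
  assumes "0 \<le> d" "d \<le> \<tau>"
  shows "min M x * d + (M - M)\<^sup>2 / (2 * k) \<le> min g x * d + (g - M)\<^sup>2 / (2 * k)"
proof -
  have "x \<le> M" using k tau x by simp
  show ?thesis
  proof (cases "g \<le> x")
    case True
    have "k * d * d \<le> k * \<tau> * d"
      using assms k tau by (intro mult_right_mono) auto
    then have "x * d \<le> M * d - k * d\<^sup>2 / 2"
      unfolding x by (simp add: algebra_simps power2_eq_square)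
    also have "\<dots> \<le> g * d + (g - M)\<^sup>2 / (2 * k)" by (rule complete_square)
    finally show ?thesis using True \<open>x \<le> M\<close> by simp
  qed (use k \<open>x \<le> M\<close> in simp)
qed

text \<open>The vertex of the parabola is nonpositive, so the constraint g \<ge> 0 binds. Above the
  cap, k \<tau> \<le> M gives x \<ge> M / 2, hence x d \<ge> M^2 / (2 k), the value at 0.\<close>

lemma penalized_min_zero:
  assumes "M \<le> k * d" "k * \<tau> \<le> M" "0 \<le> g"
  shows "min 0 x * d + (0 - M)\<^sup>2 / (2 * k) \<le> min g x * d + (g - M)\<^sup>2 / (2 * k)"
proof -
  have "0 \<le> k * \<tau>" using k tau by simp
  then have x0: "0 \<le> x" "0 \<le> M" using assms x by auto
  have d: "M / k \<le> d" using assms(1) k by (simp add: field_simps)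
  show ?thesis
  proof (cases "g \<le> x")
    case True
    have "g * (M / k) \<le> g * d"
      using d assms(3) by (intro mult_left_mono)
    moreover have "g * (M / k) + (g - M)\<^sup>2 / (2 * k) = M\<^sup>2 / (2 * k) + g\<^sup>2 / (2 * k)"
      using k by (simp add: field_simps power2_eq_square)
    moreover have "0 \<le> g\<^sup>2 / (2 * k)" using k by simp
    ultimately show ?thesis using True x0 by simp
  next
    case False
    have "x * (M / k) \<le> x * d"
      using d x0 by (intro mult_left_mono)
    moreover have "M\<^sup>2 / (2 * k) \<le> x * (M / k)"
    proof -
      have "M / 2 \<le> x" using assms(2) x by simp
      then have "(M / 2) * (M / k) \<le> x * (M / k)"
        using x0 k by (intro mult_right_mono) auto
      then show ?thesis by (simp add: power2_eq_square)
    qed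
    moreover have "0 \<le> (g - M)\<^sup>2 / (2 * k)" using k by simp
    ultimately show ?thesis using False x0 by simp
  qed
qed

end

section \<open>Optimality criteria for the order quantity and for the law\<close>

context distortion_L2
begin

text \<open>A supergradient inequality at \<open>x\<close> for the expected sales, which are concave
  in the order. On [0,s] passing from \<open>x\<close> to \<open>y\<close> adds at most y - x, and
  beyond \<open>s\<close> sales are already limited by \<open>G\<close>. The slope is the h'-mass
  \<open>h s\<close> of [0,s].\<close>

lemma expected_sales_order_bound:
  fixes G :: "real \<Rightarrow> real"
  assumes G: "G \<in> borel_measurable unif" "\<And>u. u \<in> {0<..<1} \<Longrightarrow> 0 \<le> G u"
    and "0 \<le> x" "0 \<le> y" "0 \<le> s" "s \<le> 1"
    and le: "\<And>u. u \<in> {0<..<1} \<Longrightarrow> u \<le> s \<Longrightarrow> x \<le> G u"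
    and ge: "\<And>u. u \<in> {0<..<1} \<Longrightarrow> s < u \<Longrightarrow> G u \<le> x"
  shows "(LINT u|unif. min (G u) y * hder h u) \<le> (LINT u|unif. min (G u) x * hder h u) + (y - x) * h s"
proof -
  have "(LINT u|unif. min (G u) y * hder h u)
      \<le> (LINT u|unif. min (G u) x * hder h u + (y - x) * (indicator {..s} u * hder h u))"
  proof (rule integral_mono)
    fix u assume u: "u \<in> space unif"
    have "min (G u) y \<le> min (G u) x + (y - x) * indicator {..s} u"
      using le[of u] ge[of u] u by (auto simp: indicator_def)
    then have "min (G u) y * hder h u \<le> (min (G u) x + (y - x) * indicator {..s} u) * hder h u"
      using u by (intro mult_right_mono hder_nonneg) auto
    then show "min (G u) y * hder h u \<le> min (G u) x * hder h u + (y - x) * (indicator {..s} u * hder h u)"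
      by (simp add: algebra_simps)
  qed (use min_hder_integrable[OF G] assms in \<open>auto intro!: Bochner_Integration.integrable_add\<close>)
  also have "\<dots> = (LINT u|unif. min (G u) x * hder h u) + (y - x) * h s"
    using min_hder_integrable[OF G] assms
    by (subst Bochner_Integration.integral_add) (auto simp: cum_eq_h)
  finally show ?thesis .
qed

lemma expected_sales_quadratic_bound:
  fixes G G' :: "real \<Rightarrow> real"
  assumes G: "G \<in> borel_measurable unif" "\<And>u. u \<in> {0<..<1} \<Longrightarrow> 0 \<le> G u"
    and G': "G' \<in> borel_measurable unif" "\<And>u. u \<in> {0<..<1} \<Longrightarrow> 0 \<le> G' u"
    and L2: "integrable unif G" "integrable unif (\<lambda>u. (G u)\<^sup>2)"
      "integrable unif G'" "integrable unif (\<lambda>u. (G' u)\<^sup>2)"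
    and moments: "(LINT u|unif. G u) = (LINT u|unif. G' u)"
      "(LINT u|unif. (G u)\<^sup>2) = (LINT u|unif. (G' u)\<^sup>2)"
    and "0 \<le> x"
    and le: "\<And>u. u \<in> {0<..<1} \<Longrightarrow> min (G' u) x * hder h u + (G' u - M)\<^sup>2 / (2 * k)
              \<le> min (G u) x * hder h u + (G u - M)\<^sup>2 / (2 * k)"
  shows "(LINT u|unif. min (G' u) x * hder h u) \<le> (LINT u|unif. min (G u) x * hder h u)"
proof -
  note I = min_hder_integrable[OF G \<open>0 \<le> x\<close>] min_hder_integrable[OF G' \<open>0 \<le> x\<close>]
  note S = LINT_sq_diff[OF L2(1,2), of M] LINT_sq_diff[OF L2(3,4), of M]
  have "(LINT u|unif. min (G' u) x * hder h u + (G' u - M)\<^sup>2 / (2 * k))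
      \<le> (LINT u|unif. min (G u) x * hder h u + (G u - M)\<^sup>2 / (2 * k))"
    using I S(1,3) le by (intro integral_mono) auto
  then show ?thesis
    using I S moments by simp
qed

end

text \<open>Covers case (ii), with t = 1, and case (iii). \<open>mean\<close> and
  \<open>second_moment\<close> are the moment equations of the profile below, the second multiplied
  by \<open>t\<close> and with \<open>M\<close> eliminated; \<open>below\<close> makes the profile
  nonnegative up to \<open>t\<close>, and \<open>above\<close> makes the cut-off at \<open>t\<close>
  optimal. The value k = 0 is kept for deterministic demand.\<close>

locale truncated_profile = distortion_L2 +
  fixes p c \<mu> \<sigma> \<beta> s t k M :: real
  assumes p: "0 < p" and c: "c = p * \<beta>" and hs: "h s = \<beta>" and st: "0 < s" "s < t" "t \<le> 1"
    and k: "0 \<le> k" and degenerate: "k = 0 \<Longrightarrow> \<sigma> = 0"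
    and mean: "t * M = \<mu> + k * (h t - \<beta>)"
    and second_moment: "k\<^sup>2 * (t * (LINT u|unif. indicator {s<..t} u * (hder h u)\<^sup>2) - (h t - \<beta>)\<^sup>2)
      = t * (\<mu>\<^sup>2 + \<sigma>\<^sup>2) - \<mu>\<^sup>2"
    and below: "\<And>u. 0 < u \<Longrightarrow> u < 1 \<Longrightarrow> u \<le> t \<Longrightarrow> k * hder h u \<le> M"
    and above: "\<And>u. t < u \<Longrightarrow> u < 1 \<Longrightarrow> M \<le> k * hder h u"
begin

text \<open>The candidate quantile function at level 1 - u, hence nonincreasing in
  \<open>u\<close>.\<close>

definition profile :: "real \<Rightarrow> real" where
  "profile u = (if t < u then 0 else if s < u then M - k * hder h u else M)"

definition profile_law :: "real measure" where
  "profile_law = distr unif borel profile"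

lemma s1: "s < 1" using st by simp

lemma M_nonneg: "0 \<le> M"
  using below[of s] k st s1 hder_nonneg[of s] by (meson less_imp_le mult_nonneg_nonneg order_trans)

lemma profile_nonneg: "u \<in> {0<..<1} \<Longrightarrow> 0 \<le> profile u"
  using below[of u] M_nonneg by (auto simp: profile_def)

lemma profile_antimono: "antimono_on {0<..<1} profile"
proof (rule monotone_onI)
  fix u v assume uv: "u \<in> {0<..<1::real}" "v \<in> {0<..<1}" "u \<le> v"
  have "k * hder h u \<le> k * hder h v" "0 \<le> k * hder h v"
    using uv k by (auto intro!: mult_left_mono hder_mono' hder_nonneg mult_nonneg_nonneg)
  then show "profile v \<le> profile u"
    using below[of u] M_nonneg uv by (auto simp: profile_def)
qed

lemmas profile_measurable [measurable] = antimono_measurable_unif[OF profile_antimono]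

text \<open>The breakpoints \<open>s\<close> and \<open>t\<close> belong to the pieces on their left
  and h' is left-continuous; \<open>quantile_distr_unif\<close> asks for this.\<close>

lemma profile_left_cont:
  assumes u: "u \<in> {0<..<1}"
  shows "(profile \<longlongrightarrow> profile u) (at_left u)"
proof -
  have ev: "(profile \<longlongrightarrow> l) (at_left u)"
    if "(f \<longlongrightarrow> l) (at_left u)" "a < u" "\<And>v. a < v \<Longrightarrow> v < u \<Longrightarrow> profile v = f v" for f l a
  proof (rule Lim_transform_eventually[OF that(1)])
    show "eventually (\<lambda>v. f v = profile v) (at_left u)"
      using eventually_at_left_real[OF that(2)] by eventually_elim (simp add: that(3))
  qed
  consider "u \<le> s" | "s < u" "u \<le> t" | "t < u" by linarith
  then show ?thesis
  proof cases
    case 1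
    then show ?thesis
      using ev[of "\<lambda>_. M" M 0] u st by (auto simp: profile_def)
  next
    case 2
    have "((\<lambda>v. M - k * hder h v) \<longlongrightarrow> M - k * hder h u) (at_left u)"
      using u hderiv_neq_infinity by (intro tendsto_intros hder_left_cont) auto
    from ev[OF this 2(1)] 2 show ?thesis by (simp add: profile_def)
  next
    case 3
    then show ?thesis
      using ev[of "\<lambda>_. 0" 0 t] u st by (simp add: profile_def)
  qed
qed

lemma quantile_profile_law:
  assumes "u \<in> {0<..<1}"
  shows "quantile profile_law (1 - u) = profile u"
  unfolding profile_law_def
  by (rule quantile_distr_unif[OF profile_antimono profile_left_cont assms])

abbreviation I2 :: real where
  "I2 \<equiv> (LINT u|unif. indicator {s<..t} u * (hder h u)\<^sup>2)"

lemma profile_moments: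
  "integrable unif profile" "integrable unif (\<lambda>u. (profile u)\<^sup>2)"
  "(LINT u|unif. profile u) = \<mu>" "(LINT u|unif. (profile u)\<^sup>2) = \<mu>\<^sup>2 + \<sigma>\<^sup>2"
proof -
  have eq1: "profile = (\<lambda>u. M * indicator {..t} u - k * (indicator {s<..t} u * hder h u))"
    using st by (auto simp: profile_def indicator_def fun_eq_iff)
  have eq2: "(\<lambda>u. (profile u)\<^sup>2) = (\<lambda>u. M\<^sup>2 * indicator {..t} u
      - 2 * M * k * (indicator {s<..t} u * hder h u) + k\<^sup>2 * (indicator {s<..t} u * (hder h u)\<^sup>2))"
    using st by (auto simp: profile_def indicator_def fun_eq_iff power2_eq_square algebra_simps)
  have I: "integrable unif (\<lambda>u. M * indicator {..t} u)" "integrable unif (\<lambda>u. M\<^sup>2 * indicator {..t} u)"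
    "integrable unif (\<lambda>u. k * (indicator {s<..t} u * hder h u))"
    "integrable unif (\<lambda>u. 2 * M * k * (indicator {s<..t} u * hder h u))"
    "integrable unif (\<lambda>u. k\<^sup>2 * (indicator {s<..t} u * (hder h u)\<^sup>2))"
    by (intro Bochner_Integration.integrable_mult_right integrable_indicator_unif
        indicator_hder_integrable indicator_hder_sq_integrable; simp)+
  have A: "(LINT u|unif. indicator {..t} u) = t"
    using st by (intro LINT_unif_indicator_atMost) auto
  have B: "(LINT u|unif. indicator {s<..t} u * hder h u) = h t - \<beta>"
    using LINT_hder[of s t] st hs by simp
  show "integrable unif profile"
    unfolding eq1 by (intro Bochner_Integration.integrable_diff I)
  show "integrable unif (\<lambda>u. (profile u)\<^sup>2)"
    unfolding eq2 by (intro Bochner_Integration.integrable_diff Bochner_Integration.integrable_add I)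
  have "(LINT u|unif. profile u) = M * t - k * (h t - \<beta>)"
    unfolding eq1 Bochner_Integration.integral_diff[OF I(1,3)] Bochner_Integration.integral_mult_right_zero A B ..
  then show "(LINT u|unif. profile u) = \<mu>"
    using mean by (simp add: mult.commute)
  have "(LINT u|unif. (profile u)\<^sup>2) = M\<^sup>2 * t - 2 * M * k * (h t - \<beta>) + k\<^sup>2 * I2"
    unfolding eq2 Bochner_Integration.integral_add[OF Bochner_Integration.integrable_diff[OF I(2,4)] I(5)]
      Bochner_Integration.integral_diff[OF I(2,4)] Bochner_Integration.integral_mult_right_zero A B ..
  \<comment> \<open>Multiplying by \<open>t\<close> lets \<open>mean\<close> replace
    \<open>t * M\<close>; completing the square leaves the variance term of
    \<open>second_moment\<close>.\<close>
  then have "t * (LINT u|unif. (profile u)\<^sup>2)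
      = t * (M\<^sup>2 * t - 2 * M * k * (h t - \<beta>) + k\<^sup>2 * I2)"
    by simp
  also have "\<dots> = (t * M)\<^sup>2 - 2 * (t * M) * k * (h t - \<beta>) + t * k\<^sup>2 * I2"
    by (simp add: power2_eq_square algebra_simps)
  also have "\<dots> = (t * M - k * (h t - \<beta>))\<^sup>2 + k\<^sup>2 * (t * I2 - (h t - \<beta>)\<^sup>2)"
    by (simp add: power2_eq_square algebra_simps)
  also have "\<dots> = t * (\<mu>\<^sup>2 + \<sigma>\<^sup>2)"
    unfolding second_moment using mean by simp
  finally show "(LINT u|unif. (profile u)\<^sup>2) = \<mu>\<^sup>2 + \<sigma>\<^sup>2"
    using st by simp
qed

lemma profile_law_demand: "profile_law \<in> demand_laws \<mu> \<sigma>"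
  unfolding profile_law_def
  by (rule distr_unif_demand_law[OF profile_measurable profile_nonneg profile_moments])

text \<open>\<tau> is a subgradient of \<open>h\<close> at \<open>s\<close>, separating the values
  of h' on the two sides. Any choice yields the same law and value and enters only through the order
  \<open>x\<close>. The saddle inequality in the order comes from the supergradient bound, the one
  in the law from the pointwise minimization.\<close>

lemma profile_law_saddle:
  assumes tau_ge: "\<And>u. 0 < u \<Longrightarrow> u \<le> s \<Longrightarrow> hder h u \<le> \<tau>"
    and tau_le: "\<And>u. s < u \<Longrightarrow> u < 1 \<Longrightarrow> \<tau> \<le> hder h u"
    and x: "x = M - k * \<tau> / 2"
  shows "rho_wc h p c \<mu> \<sigma> = ereal (p * (k * I2 - M * (h t - \<beta>)))"
    and "optimal_order h p c \<mu> \<sigma> x"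
    and "worst_case_law h p c \<mu> \<sigma> x profile_law"
proof -
  have tau0: "0 \<le> \<tau>" using tau_ge[of s] hder_nonneg[of s] st s1 by auto
  \<comment> \<open>A point strictly between \<open>s\<close> and \<open>t\<close> links \<tau> to
    \<open>M\<close>: k \<tau> \<le> k h'(v) \<le> M. Hence x \<ge> M / 2 \<ge> 0.\<close>
  obtain v where v: "s < v" "v < t" using dense[OF st(2)] by auto
  have "k * \<tau> \<le> k * hder h v"
    using tau_le[of v] v st k by (intro mult_left_mono) auto
  also have "\<dots> \<le> M" using below[of v] v st by auto
  finally have ktau: "k * \<tau> \<le> M" .
  have "0 \<le> k * \<tau>" using k tau0 by simp
  with ktau have x0: "0 \<le> x" and xM: "x \<le> M" unfolding x by auto
  have px: "profile u \<le> x" if u: "u \<in> {0<..<1}" "s < u" for u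
  proof -
    have "k * \<tau> \<le> k * hder h u" using tau_le[of u] u k by (intro mult_left_mono) auto
    then show ?thesis using u x0 \<open>0 \<le> k * \<tau>\<close> unfolding x by (auto simp: profile_def)
  qed
  have risk: "distortion_risk h G (newsvendor_loss y p c)
      = c * y - p * (LINT u|unif. min (quantile G (1 - u)) y * hder h u)"
    if "G \<in> demand_laws \<mu> \<sigma>" "0 \<le> y" for G y
    using demand_law_quantile(1,2)[OF that(1)] p that(2) by (intro distortion_risk_newsvendor)
  have riskF: "distortion_risk h profile_law (newsvendor_loss y p c)
      = c * y - p * (LINT u|unif. min (profile u) y * hder h u)" if "0 \<le> y" for y
    unfolding risk[OF profile_law_demand that]
    by (auto intro!: Bochner_Integration.integral_cong simp: quantile_profile_law)
  have order: "distortion_risk h profile_law (newsvendor_loss x p c)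
      \<le> distortion_risk h profile_law (newsvendor_loss y p c)" if y: "0 \<le> y" for y
  proof -
    have "(LINT u|unif. min (profile u) y * hder h u)
        \<le> (LINT u|unif. min (profile u) x * hder h u) + (y - x) * h s"
    proof (rule expected_sales_order_bound[OF profile_measurable profile_nonneg x0 y])
      show "x \<le> profile u" if "u \<in> {0<..<1}" "u \<le> s" for u
        using that xM st by (auto simp: profile_def)
    qed (use px st in auto)
    then have "p * (LINT u|unif. min (profile u) y * hder h u)
        \<le> p * ((LINT u|unif. min (profile u) x * hder h u) + (y - x) * h s)"
      using p by (intro mult_left_mono) auto
    \<comment> \<open>Since c = p h(s), the extra purchase cost c (y - x) cancels the bound on the
      extra revenue.\<close>
    then show ?thesis
      unfolding riskF[OF y] riskF[OF x0] using c hs by (simp add: algebra_simps)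
  qed
  have law: "distortion_risk h G (newsvendor_loss x p c)
      \<le> distortion_risk h profile_law (newsvendor_loss x p c)" if G: "G \<in> demand_laws \<mu> \<sigma>" for G
  proof -
    note q = demand_law_quantile[OF G]
    have "(LINT u|unif. min (profile u) x * hder h u)
        \<le> (LINT u|unif. min (quantile G (1 - u)) x * hder h u)"
    proof (cases "k = 0")
      case True
      then have "\<sigma> = 0" by (rule degenerate)
      with zero_variance_AE[of profile \<mu>] zero_variance_AE[of "\<lambda>u. quantile G (1 - u)" \<mu>]
      have "AE u in unif. profile u = \<mu>" "AE u in unif. quantile G (1 - u) = \<mu>"
        using profile_moments q by auto
      then have "AE u in unif. min (profile u) x * hder h u = min (quantile G (1 - u)) x * hder h u"
        by eventually_elim simp
      then have "(LINT u|unif. min (profile u) x * hder h u)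
          = (LINT u|unif. min (quantile G (1 - u)) x * hder h u)"
        using q(3) by (intro integral_cong_AE) auto
      then show ?thesis by simp
    next
      case False
      then have k0: "0 < k" using k by simp
      show ?thesis
      proof (rule expected_sales_quadratic_bound[where M = M and k = k, OF q(3,4) profile_measurable profile_nonneg])
        fix u :: real assume u: "u \<in> {0<..<1}"
        consider "u \<le> s" | "s < u" "u \<le> t" | "t < u" by linarith
        then show "min (profile u) x * hder h u + (profile u - M)\<^sup>2 / (2 * k)
              \<le> min (quantile G (1 - u)) x * hder h u + (quantile G (1 - u) - M)\<^sup>2 / (2 * k)"
        proof cases
          case 1
          then have "profile u = M" using st by (simp add: profile_def)
          then show ?thesis
            using penalized_min_high[OF k0 x tau0, of "hder h u"] 1 u tau_ge[of u] hder_nonneg[of u] by simp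
        next
          case 2
          then have "profile u = M - k * hder h u" by (simp add: profile_def)
          then show ?thesis
            using penalized_min_low[OF k0 x tau0, of "hder h u"] 2 u tau_le[of u] by simp
        next
          case 3
          then have "profile u = 0" by (simp add: profile_def)
          then show ?thesis
            using penalized_min_zero[OF k0 x tau0 above[of u] ktau q(4)[OF u]] 3 u by simp
        qed
      qed (use q profile_moments x0 in auto)
    qed
    then show ?thesis
      unfolding risk[OF G x0] riskF[OF x0] using p by simp
  qed
  \<comment> \<open>Under the profile, sales equal \<open>x\<close> on [0,s] and the demand itself
    beyond \<open>s\<close>; the first part cancels against the cost.\<close>
  have "(LINT u|unif. min (profile u) x * hder h u)
    = (LINT u|unif. x * (indicator {..s} u * hder h u) + (M * (indicator {s<..t} u * hder h u)
          - k * (indicator {s<..t} u * (hder h u)\<^sup>2)))"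
  proof (rule Bochner_Integration.integral_cong)
    fix u assume "u \<in> space unif"
    then show "min (profile u) x * hder h u = x * (indicator {..s} u * hder h u)
        + (M * (indicator {s<..t} u * hder h u) - k * (indicator {s<..t} u * (hder h u)\<^sup>2))"
      using px[of u] xM x0 st
      by (auto simp: profile_def indicator_def min_def power2_eq_square algebra_simps)
  qed simp
  also have "\<dots> = x * \<beta> + (M * (h t - \<beta>) - k * I2)"
    using LINT_hder[of s t] cum_eq_h[of s] st hs by simp
  finally have E: "(LINT u|unif. min (profile u) x * hder h u) = x * \<beta> + (M * (h t - \<beta>) - k * I2)" .
  have "distortion_risk h profile_law (newsvendor_loss x p c) = p * (k * I2 - M * (h t - \<beta>))"
    unfolding riskF[OF x0] E using c by (simp add: algebra_simps)
  with saddle_point_optimal[OF profile_law_demand x0 order law]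
  show "rho_wc h p c \<mu> \<sigma> = ereal (p * (k * I2 - M * (h t - \<beta>)))"
    "optimal_order h p c \<mu> \<sigma> x" "worst_case_law h p c \<mu> \<sigma> x profile_law"
    by auto
qed

end

section \<open>Subgradients at \<open>s\<close> and the two-point law of case (i)\<close>

context distortion_L2
begin

text \<open>By monotonicity the right limit at \<open>s\<close> exists and equals the infimum of h'
  over (s,1).\<close>

lemma hderiv_le_right_limit:
  assumes u: "0 < s" "s < u" "u < 1"
  shows "hderiv_right_limit h s \<le> hderiv h u"
proof -
  have "(hderiv h \<longlongrightarrow> (INF v\<in>{s<..<1}. hderiv h v)) (at_right s)"
  proof (rule order_tendstoI)
    fix a assume a: "a < (INF v\<in>{s<..<1}. hderiv h v)"
    have "eventually (\<lambda>w. w \<in> {s<..<1}) (at_right s)"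
      using u by (intro eventually_at_right_real) auto
    then show "eventually (\<lambda>w. a < hderiv h w) (at_right s)"
      by eventually_elim (rule less_le_trans[OF a INF_lower])
  next
    fix a assume "(INF v\<in>{s<..<1}. hderiv h v) < a"
    then obtain v where v: "v \<in> {s<..<1}" "hderiv h v < a"
      by (auto simp: INF_less_iff)
    have "eventually (\<lambda>w. w \<in> {s<..<v}) (at_right s)"
      using v by (intro eventually_at_right_real) auto
    then show "eventually (\<lambda>w. hderiv h w < a) (at_right s)"
    proof eventually_elim
      case (elim w)
      then show ?case using hderiv_mono[of w v] u v by auto
    qed
  qed
  then have "hderiv_right_limit h s = (INF v\<in>{s<..<1}. hderiv h v)"
    unfolding hderiv_right_limit_def by (intro tendsto_Lim) auto
  then show ?thesis using u by (auto intro: INF_lower)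
qed

lemma subgradient_bounds:
  assumes "0 < s" "s < 1" "hderiv h s \<le> ereal \<tau>" "ereal \<tau> \<le> hderiv_right_limit h s"
  shows "0 < u \<Longrightarrow> u \<le> s \<Longrightarrow> hder h u \<le> \<tau>"
    and "s < u \<Longrightarrow> u < 1 \<Longrightarrow> \<tau> \<le> hder h u"
proof -
  assume u: "0 < u" "u \<le> s"
  have "ereal (hder h s) \<le> ereal \<tau>"
    using assms(3) by (simp only: hderiv_finite[OF assms(1,2), symmetric])
  then show "hder h u \<le> \<tau>" using hder_mono'[of u s] u assms by simp
next
  assume u: "s < u" "u < 1"
  then have "0 < u" using assms by simp
  have "ereal \<tau> \<le> hderiv h u"
    using assms(4) hderiv_le_right_limit[OF assms(1) u] by (rule order_trans)
  then have "ereal \<tau> \<le> ereal (hder h u)"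
    by (simp only: hderiv_finite[OF \<open>0 < u\<close> u(2), symmetric])
  then show "\<tau> \<le> hder h u" by simp
qed

text \<open>Ordering nothing has zero loss under every law, so every admissible law is worst at x =
  0. What remains is that 0 is optimal against \<open>F\<close>: in the representation on (0,1) its
  demand vanishes beyond t0 \<le> s, so an order \<open>y\<close> earns at most p y h(s) = c
  y.\<close>

lemma two_point_law_optimal:
  assumes "0 < p" "c = p * h s" "0 < \<mu>" "t0 = \<mu>\<^sup>2 / (\<mu>\<^sup>2 + \<sigma>\<^sup>2)" "t0 \<le> s" "s \<le> 1"
  defines "F \<equiv> distr unif borel (\<lambda>u. (\<mu>\<^sup>2 + \<sigma>\<^sup>2) / \<mu> * indicator {..t0} u)"
  shows "rho_wc h p c \<mu> \<sigma> = 0" "optimal_order h p c \<mu> \<sigma> 0" "worst_case_law h p c \<mu> \<sigma> 0 F"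
    and "measure F {(\<mu>\<^sup>2 + \<sigma>\<^sup>2) / \<mu>} = t0" "measure F {0} = 1 - t0"
proof -
  define m where "m = (\<mu>\<^sup>2 + \<sigma>\<^sup>2) / \<mu>"
  define G where "G u = m * indicator {..t0} u" for u :: real
  have F: "F = distr unif borel G" by (simp add: F_def G_def[abs_def] m_def)
  have pos: "0 < \<mu>\<^sup>2 + \<sigma>\<^sup>2" using assms(3) by (simp add: add_pos_nonneg)
  then have m0: "0 < m" and t0: "0 < t0" "t0 \<le> 1" using assms(3,4) by (auto simp: m_def)
  \<comment> \<open>The value \<open>m\<close> and the mass \<open>t0\<close> solve the two moment
    equations for a law on 0 and one further point.\<close>
  have mt: "m * t0 = \<mu>" "m\<^sup>2 * t0 = \<mu>\<^sup>2 + \<sigma>\<^sup>2"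
    unfolding m_def assms(4) using pos assms(3) by (simp_all add: power2_eq_square)
  have anti: "antimono_on {0<..<1} G"
    using m0 by (auto intro!: monotone_onI simp: G_def indicator_def)
  note Gm [measurable] = antimono_measurable_unif[OF anti]
  have G0: "0 \<le> G u" for u using m0 by (simp add: G_def)
  have left: "(G \<longlongrightarrow> G u) (at_left u)" if u: "u \<in> {0<..<1}" for u
  proof -
    have "eventually (\<lambda>v. G v = G u) (at_left u)"
      using eventually_at_left_real[of "if u \<le> t0 then u - 1 else t0" u]
      by (rule eventually_mono) (auto simp: G_def indicator_def split: if_splits)
    then show ?thesis by (rule tendsto_eventually)
  qed
  have quantile_F: "quantile F (1 - u) = G u" if "u \<in> {0<..<1}" for u
    unfolding F by (rule quantile_distr_unif[OF anti left that])
  have sq: "(\<lambda>u. (G u)\<^sup>2) = (\<lambda>u. m\<^sup>2 * indicator {..t0} u)"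
    by (auto simp: G_def indicator_def)
  have I: "integrable unif (indicator {..t0} :: real \<Rightarrow> real)"
    by (rule integrable_indicator_unif) simp
  have L: "(LINT u|unif. indicator {..t0} u) = t0"
    using t0 by (intro LINT_unif_indicator_atMost) auto
  have law: "F \<in> demand_laws \<mu> \<sigma>"
    unfolding F
  proof (rule distr_unif_demand_law[OF Gm G0])
    show "integrable unif G" "integrable unif (\<lambda>u. (G u)\<^sup>2)"
      unfolding sq unfolding G_def using I by (auto intro!: Bochner_Integration.integrable_mult_right)
    show "(LINT u|unif. G u) = \<mu>" "(LINT u|unif. (G u)\<^sup>2) = \<mu>\<^sup>2 + \<sigma>\<^sup>2"
      unfolding sq unfolding G_def Bochner_Integration.integral_mult_right_zero L mt by simp_all
  qed
  have risk: "distortion_risk h H (newsvendor_loss y p c)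
      = c * y - p * (LINT u|unif. min (quantile H (1 - u)) y * hder h u)"
    if "H \<in> demand_laws \<mu> \<sigma>" "0 \<le> y" for H y
    using demand_law_quantile(1,2)[OF that(1)] assms(1) that(2) by (intro distortion_risk_newsvendor)
  have zero: "distortion_risk h H (newsvendor_loss 0 p c) = 0" if H: "H \<in> demand_laws \<mu> \<sigma>" for H
  proof -
    have "(LINT u|unif. min (quantile H (1 - u)) 0 * hder h u) = (LINT u|unif. 0)"
      using demand_law_quantile(4)[OF H]
      by (intro Bochner_Integration.integral_cong) (auto simp: min_def intro: antisym)
    then show ?thesis using risk[OF H, of 0] by simp
  qed
  have order: "distortion_risk h F (newsvendor_loss 0 p c) \<le> distortion_risk h F (newsvendor_loss y p c)"
    if y: "0 \<le> y" for y
  proof -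
    have "(LINT u|unif. min (G u) y * hder h u) \<le> (LINT u|unif. min (G u) 0 * hder h u) + (y - 0) * h s"
    proof (rule expected_sales_order_bound[OF Gm G0 order_refl y])
      show "G u \<le> 0" if "s < u" for u using that assms(5) by (simp add: G_def)
    qed (use assms(5,6) t0 G0 in auto)
    also have "(LINT u|unif. min (G u) 0 * hder h u) = (LINT u|unif. 0)"
      using G0 by (intro Bochner_Integration.integral_cong) (auto simp: min_def intro: antisym)
    finally have "(LINT u|unif. min (G u) y * hder h u) \<le> y * h s"
      by simp
    then have "p * (LINT u|unif. min (G u) y * hder h u) \<le> p * (y * h s)"
      using assms(1) by (intro mult_left_mono) auto
    moreover have E: "(LINT u|unif. min (quantile F (1 - u)) y * hder h u) = (LINT u|unif. min (G u) y * hder h u)"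
      by (rule Bochner_Integration.integral_cong) (auto simp: quantile_F)
    moreover have "c * y = p * (y * h s)" by (simp add: assms(2))
    ultimately show ?thesis
      unfolding zero[OF law] risk[OF law y] E by linarith
  qed
  have worst: "distortion_risk h H (newsvendor_loss 0 p c) \<le> distortion_risk h F (newsvendor_loss 0 p c)"
    if "H \<in> demand_laws \<mu> \<sigma>" for H
    using zero[OF that] zero[OF law] by simp
  have "rho_wc h p c \<mu> \<sigma> = ereal (distortion_risk h F (newsvendor_loss 0 p c))"
    by (rule saddle_point_optimal(1)[OF law order_refl]; fact order worst)
  then show "rho_wc h p c \<mu> \<sigma> = 0"
    unfolding zero[OF law] by simp
  show "optimal_order h p c \<mu> \<sigma> 0"
    by (rule saddle_point_optimal(2)[OF law order_refl]; fact order worst)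
  show "worst_case_law h p c \<mu> \<sigma> 0 F"
    by (rule saddle_point_optimal(3)[OF law order_refl]; fact order worst)
  have mt0: "measure unif ({..t0} \<inter> {0<..<1}) = t0"
    using L by (simp only: Bochner_Integration.integral_indicator space_unif)
  have G_iff: "G u = m \<longleftrightarrow> u \<le> t0" "G u = 0 \<longleftrightarrow> \<not> u \<le> t0" for u
    using m0 by (simp_all add: G_def indicator_def)
  have "measure F {m} = measure unif (G -` {m} \<inter> space unif)"
    unfolding F by (rule measure_distr) auto
  also have "G -` {m} \<inter> space unif = {..t0} \<inter> {0<..<1}"
    unfolding vimage_def by (simp add: G_iff set_eq_iff)
  finally show "measure F {(\<mu>\<^sup>2 + \<sigma>\<^sup>2) / \<mu>} = t0" using mt0 by (simp add: m_def)
  have "measure F {0} = measure unif (G -` {0} \<inter> space unif)"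
    unfolding F by (rule measure_distr) auto
  also have "G -` {0} \<inter> space unif = space unif - ({..t0} \<inter> {0<..<1})"
    unfolding vimage_def by (simp add: G_iff set_eq_iff) blast
  also have "measure unif \<dots> = 1 - t0"
  proof -
    have "{..t0} \<inter> {0<..<1} \<in> sets unif" by (auto simp: sets_restrict_space)
    from unif.prob_compl[OF this] show ?thesis using mt0 by simp
  qed
  finally show "measure F {0} = 1 - t0" .
qed

end

section \<open>The truncation point\<close>

locale distortion_level = distortion_L2 +
  fixes s \<beta> :: real
  assumes hs: "h s = \<beta>" and \<beta>: "0 < \<beta>" and s: "0 < s" "s < 1"
begin

abbreviation J :: "real \<Rightarrow> real" where
  "J t \<equiv> (LINT u|unif. indicator {s<..t} u * (hder h u)\<^sup>2)"

text \<open>The square of \<open>Delta\<close>. It is t^2 times the variance, under the uniform law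
  on (0,t], of h' set to 0 outside (s,t].\<close>

definition Dsq :: "real \<Rightarrow> real" where
  "Dsq t = t * J t - (h t - \<beta>)\<^sup>2"

text \<open>If \<open>M\<close> is fixed by the mean, \<open>\<mu> - k * A t\<close> is
  \<open>t\<close> times the height M - k h'(t) of the profile at \<open>t\<close>, so k A(t) \<le>
  \<mu> states nonnegativity there.\<close>

definition A :: "real \<Rightarrow> real" where
  "A t = t * hder h t - h t + \<beta>"

lemma LINT_sq: "t \<le> 1 \<Longrightarrow> (LINT u:{s..t}|lborel. (hder h u)\<^sup>2) = J t"
  using s by (intro LINT_unif_Icc) auto

lemma Delta_eq: "t \<le> 1 \<Longrightarrow> Delta h \<beta> s t = sqrt (Dsq t)"
  by (simp add: Delta_def Dsq_def LINT_sq)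

text \<open>The chord from 0 to \<open>s\<close> has slope \<beta> / s > 0, and the slopes of later
  chords are no smaller.\<close>

lemma h_gt: "s < t \<Longrightarrow> t \<le> 1 \<Longrightarrow> \<beta> < h t"
proof -
  assume t: "s < t" "t \<le> 1"
  have "0 < slope 0 s" using hs \<beta> s by simp
  also have "slope 0 s \<le> slope 0 t" using t s by (intro slope_mono) auto
  also have "\<dots> \<le> slope s t" using t s by (intro slope_mono) auto
  finally show "\<beta> < h t" using hs t by (simp add: zero_less_divide_iff)
qed

text \<open>Cauchy-Schwarz on (s,t] gives (h(t) - \<beta>)^2 \<le> (t - s) J(t); strictness comes
  from t - s < t and h(t) > \<beta>.\<close>

lemma Dsq_pos:
  assumes t: "s < t" "t \<le> 1"
  shows "0 < Dsq t"
proof -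
  define H where "H = h t - \<beta>"
  \<comment> \<open>The mean of h' over (s,t], so that the integrated squared deviation below is the
    defect in Cauchy-Schwarz.\<close>
  define m where "m = H / (t - s)"
  have H: "0 < H" using h_gt[OF t] by (simp add: H_def)
  have I: "integrable unif (indicator {s<..t} :: real \<Rightarrow> real)"
    by (rule integrable_indicator_unif) simp
  have "0 \<le> (LINT u|unif. indicator {s<..t} u * (hder h u - m)\<^sup>2)"
    by (rule integral_nonneg_AE, rule AE_I2) auto
  also have "\<dots> = (LINT u|unif. indicator {s<..t} u * (hder h u)\<^sup>2 - 2 * m * (indicator {s<..t} u * hder h u)
      + m\<^sup>2 * indicator {s<..t} u)"
    by (rule Bochner_Integration.integral_cong) (auto simp: power2_eq_square algebra_simps)
  also have "\<dots> = J t - 2 * m * (LINT u|unif. indicator {s<..t} u * hder h u)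
      + m\<^sup>2 * (LINT u|unif. indicator {s<..t} u)"
  proof -
    have a: "integrable unif (\<lambda>u. 2 * m * (indicator {s<..t} u * hder h u))"
      "integrable unif (\<lambda>u. m\<^sup>2 * indicator {s<..t} u)"
      "integrable unif (\<lambda>u. indicator {s<..t} u * (hder h u)\<^sup>2)"
      by (intro Bochner_Integration.integrable_mult_right indicator_hder_integrable I
          indicator_hder_sq_integrable; simp)+
    show ?thesis
      unfolding Bochner_Integration.integral_add[OF Bochner_Integration.integrable_diff[OF a(3,1)] a(2)]
        Bochner_Integration.integral_diff[OF a(3,1)] Bochner_Integration.integral_mult_right_zero ..
  qed
  also have "\<dots> = J t - 2 * m * H + m\<^sup>2 * (t - s)"
    using LINT_hder[of s t] LINT_unif_indicator[of s t] t s hs by (simp add: H_def)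
  also have "\<dots> = J t - H\<^sup>2 / (t - s)"
  proof -
    have "m * H = H\<^sup>2 / (t - s)" "m\<^sup>2 * (t - s) = H\<^sup>2 / (t - s)"
      using t by (simp_all add: m_def power2_eq_square)
    then show ?thesis by simp
  qed
  finally have "t * (H\<^sup>2 / (t - s)) \<le> t * J t"
    using t s by (intro mult_left_mono) auto
  moreover have "H\<^sup>2 < t * (H\<^sup>2 / (t - s))"
    using t s H by (simp add: field_simps)
  ultimately show ?thesis by (simp add: Dsq_def H_def)
qed

lemma Dsq_cont: "continuous_on {s..1} Dsq"
proof -
  have I: "set_integrable lborel {s..t} (\<lambda>u. (hder h u)\<^sup>2)" if "t \<le> 1" for t
    by (rule set_integrable_subset[OF hder_sq_set_integrable]) (use that s in auto)
  have "continuous_on {s..1} (\<lambda>t. integral {s..t} (\<lambda>u. (hder h u)\<^sup>2))"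
    by (rule indefinite_integral_continuous_1) (rule set_borel_integral_eq_integral(1)[OF I], simp)
  then have "continuous_on {s..1} J"
    by (rule continuous_on_eq) (simp add: set_borel_integral_eq_integral(2)[OF I, symmetric] LINT_sq)
  then show ?thesis
    unfolding Dsq_def[abs_def] using s
    by (intro continuous_intros continuous_on_subset[OF h_cont]) auto
qed

lemma A_pos:
  assumes "0 < t" "t \<le> 1" "hderiv h t \<noteq> \<infinity>"
  shows "0 < A t"
  using tangent_nonneg[OF assms] \<beta> by (simp add: A_def)

text \<open>Converts the condition defining \<open>t_star\<close>, up to the positive factor
  \<open>t\<close>, into a comparison of \<open>A\<close> with \<open>Dsq\<close>. The square is
  expanded and integrated termwise, as h' has mass h(t) - \<beta> on (s,t].\<close>

lemma second_moment_condition: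
  assumes t: "s < t" "t \<le> 1"
  shows "t * ((1 + r\<^sup>2) * (t * hder h t - h t + \<beta>)\<^sup>2
      - (LINT u:{0..t}|lborel. (hder h t - hder h u * indicator {s<..} u)\<^sup>2))
    = (t * (1 + r\<^sup>2) - 1) * (A t)\<^sup>2 - Dsq t"
proof -
  define d where "d = hder h t"
  have I: "integrable unif (indicator {0<..t} :: real \<Rightarrow> real)"
    by (rule integrable_indicator_unif) simp
  have [measurable]: "(\<lambda>u. (d - hder h u * indicator {s<..} u)\<^sup>2) \<in> borel_measurable unif"
    using indicator_measurable_unif[of "{s<..}"] by (intro borel_measurable_power borel_measurable_diff borel_measurable_times) auto
  have "(LINT u:{0..t}|lborel. (d - hder h u * indicator {s<..} u)\<^sup>2)
      = (LINT u|unif. indicator {0<..t} u * (d - hder h u * indicator {s<..} u)\<^sup>2)"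
    by (rule LINT_unif_Icc) (use t in auto)
  also have "\<dots> = (LINT u|unif. d\<^sup>2 * indicator {0<..t} u - 2 * d * (indicator {s<..t} u * hder h u)
      + indicator {s<..t} u * (hder h u)\<^sup>2)"
    using s by (intro Bochner_Integration.integral_cong)
      (auto simp: indicator_def power2_eq_square algebra_simps)
  also have "\<dots> = d\<^sup>2 * (LINT u|unif. indicator {0<..t} u)
      - 2 * d * (LINT u|unif. indicator {s<..t} u * hder h u) + J t"
  proof -
    have a: "integrable unif (\<lambda>u. d\<^sup>2 * indicator {0<..t} u)"
      "integrable unif (\<lambda>u. 2 * d * (indicator {s<..t} u * hder h u))"
      "integrable unif (\<lambda>u. indicator {s<..t} u * (hder h u)\<^sup>2)"
      by (intro Bochner_Integration.integrable_mult_right indicator_hder_integrable I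
          indicator_hder_sq_integrable; simp)+
    show ?thesis
      unfolding Bochner_Integration.integral_add[OF Bochner_Integration.integrable_diff[OF a(1,2)] a(3)]
        Bochner_Integration.integral_diff[OF a(1,2)] Bochner_Integration.integral_mult_right_zero ..
  qed
  also have "\<dots> = d\<^sup>2 * t - 2 * d * (h t - \<beta>) + J t"
    using LINT_hder[of s t] LINT_unif_indicator[of 0 t] t s hs by simp
  finally have E: "(LINT u:{0..t}|lborel. (d - hder h u * indicator {s<..} u)\<^sup>2)
      = d\<^sup>2 * t - 2 * d * (h t - \<beta>) + J t" .
  show ?thesis
    unfolding A_def Dsq_def d_def[symmetric] E by (simp add: power2_eq_square algebra_simps)
qed

end

section \<open>The sign of the truncation condition and its last admissible point\<close>

context distortion_level
begin

text \<open>With k \<ge> 0 and k^2 Dsq(t) = \<mu>^2 (t (1 + r^2) - 1), as the second moment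
  requires, a nonpositive value means k A(t) \<le> \<mu>: the profile cut off at \<open>t\<close> is
  nonnegative.\<close>

definition gap :: "real \<Rightarrow> real \<Rightarrow> real" where
  "gap r t = (t * (1 + r\<^sup>2) - 1) * (A t)\<^sup>2 - Dsq t"

lemma Dsq_tendsto:
  assumes "s \<le> t" "t \<le> 1"
  shows "(Dsq \<longlongrightarrow> Dsq t) (at t within {s..1})"
  using Dsq_cont assms by (auto simp: continuous_on_def)

lemma h_tendsto:
  assumes "0 \<le> t" "t \<le> 1"
  shows "(h \<longlongrightarrow> h t) (at t within {0..1})"
  using h_cont assms by (auto simp: continuous_on_def)

lemma gap_left_cont:
  assumes "s < t" "t \<le> 1" "hderiv h t \<noteq> \<infinity>"
  shows "(gap r \<longlongrightarrow> gap r t) (at_left t)"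
  unfolding gap_def[abs_def] A_def
  by (intro tendsto_intros hder_left_cont tendsto_at_left_Icc[OF Dsq_tendsto] tendsto_at_left_Icc[OF h_tendsto])
     (use assms s in auto)

text \<open>\<open>gap_left_cont\<close> does not apply at 1, where \<open>hder h\<close> is then 0.
  Instead \<open>A\<close> tends to infinity from the left while \<open>Dsq\<close> stays bounded
  and the coefficient tends to r^2 > 0.\<close>

lemma gap_pos_near_1:
  assumes inf: "hderiv h 1 = \<infinity>" and r: "0 < r"
  shows "eventually (\<lambda>v. 0 < gap r v) (at_left 1)"
proof -
  define B where "B = Dsq 1 + 1"
  have B: "0 < B" using Dsq_pos[of 1] s by (simp add: B_def)
  \<comment> \<open>Chosen so that r^2 / 2 times \<open>L\<close> is B + r^2 / 2; since L \<ge> 1, a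
    lower bound \<open>L\<close> on \<open>A\<close> is also one on its square.\<close>
  define L where "L = 1 + 2 * B / r\<^sup>2"
  have L1: "1 \<le> L" using B r by (simp add: L_def)
  have "(Dsq \<longlongrightarrow> Dsq 1) (at_left 1)"
    by (rule tendsto_at_left_Icc[OF Dsq_tendsto]) (use s in auto)
  then have e1: "eventually (\<lambda>v. Dsq v < B) (at_left 1)"
    by (rule order_tendstoD) (simp add: B_def)
  \<comment> \<open>For v > 1/2 this forces v h'(v) \<ge> L + 1, and h(v) \<le> 1 leaves A(v) \<ge>
    L.\<close>
  have "eventually (\<lambda>v. ereal (2 * (L + 1)) < hderiv h v) (at_left 1)"
    using hderiv_left_cont[of 1] inf by (intro order_tendstoD(1)[of _ \<infinity>]) auto
  moreover have "((\<lambda>v. v * (1 + r\<^sup>2) - 1) \<longlongrightarrow> 1 * (1 + r\<^sup>2) - 1) (at_left 1)"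
    by (intro tendsto_intros)
  then have "eventually (\<lambda>v. r\<^sup>2 / 2 < v * (1 + r\<^sup>2) - 1) (at_left 1)"
    by (rule order_tendstoD) (use r in simp)
  moreover have "eventually (\<lambda>v. v \<in> {1/2<..<1}) (at_left (1::real))"
    by (rule eventually_at_left_real) simp
  ultimately show ?thesis using e1
  proof eventually_elim
    case (elim v)
    then have v: "0 < v" "v < 1" by auto
    have "ereal (2 * (L + 1)) < ereal (hder h v)"
      using elim(1) by (simp only: hderiv_finite[OF v, symmetric])
    then have d: "2 * (L + 1) < hder h v" by simp
    have "1/2 * (2 * (L + 1)) \<le> v * hder h v"
      using d elim(3) L1 by (intro mult_mono) auto
    then have "L \<le> A v"
      using h_le_1[of v] v \<beta> by (simp add: A_def)
    then have "L * L \<le> A v * A v" using L1 by (intro mult_mono) auto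
    moreover have "L * 1 \<le> L * L" using L1 by (intro mult_left_mono) auto
    ultimately have "L \<le> (A v)\<^sup>2" by (simp add: power2_eq_square)
    then have "r\<^sup>2 / 2 * L \<le> (v * (1 + r\<^sup>2) - 1) * (A v)\<^sup>2"
    proof (rule mult_mono[OF less_imp_le[OF elim(2)]])
      show "0 \<le> v * (1 + r\<^sup>2) - 1"
        by (rule order_trans[OF _ less_imp_le[OF elim(2)]]) simp
    qed (use L1 in auto)
    moreover have "r\<^sup>2 / 2 * L = r\<^sup>2 / 2 + B"
      using r by (simp add: L_def field_simps)
    moreover have "0 < r\<^sup>2 / 2" using r by simp
    ultimately show ?case unfolding gap_def using elim(4) by linarith
  qed
qed

text \<open>The set of admissible points contains its lower end 1 / (1 + r^2), where the coefficient
  vanishes and the gap is -Dsq. Its supremum is attained: the set is approached from below, so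
  left-continuity of the gap suffices, or its positivity near 1 when h'(1) is infinite.\<close>

lemma t_star_properties:
  assumes r: "0 < r" and t0: "s < 1 / (1 + r\<^sup>2)"
  defines "t \<equiv> t_star h \<beta> r s"
  shows "1 / (1 + r\<^sup>2) \<le> t" "t \<le> 1" "hderiv h t \<noteq> \<infinity>" "gap r t \<le> 0"
    and "\<And>v. t < v \<Longrightarrow> v < 1 \<Longrightarrow> 0 < gap r v"
proof -
  define a where "a = 1 / (1 + r\<^sup>2)"
  have r2: "0 < 1 + r\<^sup>2" by (simp add: add_pos_nonneg)
  have a: "s < a" "a < 1" "a * (1 + r\<^sup>2) = 1"
    using t0 r r2 by (auto simp: a_def field_simps)
  define S where "S = {u. a \<le> u \<and> u \<le> 1 \<and> hderiv h u \<noteq> \<infinity> \<and> gap r u \<le> 0}"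
  define T where "T = Sup S"
  have bdd: "bdd_above S" by (rule bdd_aboveI[of _ 1]) (auto simp: S_def)
  have aS: "a \<in> S"
    using a s Dsq_pos[of a] hderiv_neq_infinity[of a] by (auto simp: S_def gap_def)
  have T: "a \<le> T" "T \<le> 1"
    unfolding T_def using aS by (auto intro!: cSup_upper bdd cSup_least simp: S_def)
  have TS: "T \<in> S"
  proof (rule ccontr)
    assume nT: "T \<notin> S"
    then have aT: "a < T" using T aS by (cases "a = T") auto
    \<comment> \<open>A supremum outside the set has a left neighbourhood on which the gap is
      positive, so the set would end earlier.\<close>
    have "eventually (\<lambda>v. 0 < gap r v) (at_left T)"
    proof (cases "hderiv h T = \<infinity>")
      case True
      then have "T = 1" using hderiv_neq_infinity[of T] T a s by (cases "T < 1") auto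
      then show ?thesis using gap_pos_near_1[OF _ r] True by simp
    next
      case False
      then have "0 < gap r T" using nT T by (auto simp: S_def)
      moreover have "(gap r \<longlongrightarrow> gap r T) (at_left T)"
        using False T aT a by (intro gap_left_cont) auto
      ultimately show ?thesis by (intro order_tendstoD(1))
    qed
    then obtain b where b: "b < T" "\<And>v. b < v \<Longrightarrow> v < T \<Longrightarrow> 0 < gap r v"
      by (auto simp: eventually_at_left_field)
    have "T \<le> b"
      unfolding T_def
    proof (rule cSup_least)
      fix u assume u: "u \<in> S"
      then have "u \<le> T" unfolding T_def by (rule cSup_upper[OF _ bdd])
      moreover have "u \<noteq> T" using u nT by auto
      ultimately show "u \<le> b" using b(2)[of u] u by (cases "b < u") (auto simp: S_def)
    qed (use aS in auto)
    then show False using b by simp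
  qed
  have cond: "u \<in> {1 / (1 + r\<^sup>2)..1} \<and> hderiv h u \<noteq> \<infinity> \<and>
        (1 + r\<^sup>2) * (u * hder h u - h u + \<beta>)\<^sup>2
          - (LINT v:{0..u}|lborel. (hder h u - hder h v * indicator {s<..} v)\<^sup>2) \<le> 0
      \<longleftrightarrow> u \<in> S" for u
  proof (cases "a \<le> u \<and> u \<le> 1")
    case True
    define X where "X = (1 + r\<^sup>2) * (u * hder h u - h u + \<beta>)\<^sup>2
          - (LINT v:{0..u}|lborel. (hder h u - hder h v * indicator {s<..} v)\<^sup>2)"
    have "u * X = gap r u"
      unfolding X_def gap_def by (rule second_moment_condition) (use True a in auto)
    then have "X \<le> 0 \<longleftrightarrow> gap r u \<le> 0"
      using True a s by (metis less_le_trans less_trans mult_le_0_iff mult_zero_right not_less order_less_imp_le)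
    then show ?thesis using True by (simp add: S_def X_def[symmetric] a_def[symmetric])
  qed (auto simp: S_def a_def)
  have "t = T"
    unfolding t_def t_star_def cond
    by (rule Greatest_equality[where P = "\<lambda>u. u \<in> S" and x = T])
       (use TS in \<open>auto simp: T_def intro: cSup_upper bdd\<close>)
  then show "1 / (1 + r\<^sup>2) \<le> t" "t \<le> 1" "hderiv h t \<noteq> \<infinity>" "gap r t \<le> 0"
    using TS by (auto simp: S_def a_def)
  fix v assume v: "t < v" "v < 1"
  show "0 < gap r v"
  proof (rule ccontr)
    assume "\<not> 0 < gap r v"
    then have "v \<in> S" using v T \<open>t = T\<close> hderiv_neq_infinity[of v] a s by (auto simp: S_def)
    then have "v \<le> T" unfolding T_def by (rule cSup_upper[OF _ bdd])
    then show False using v \<open>t = T\<close> by simp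
  qed
qed

text \<open>Positivity of the gap right of \<open>t\<close> does not pass to the limit directly, as
  h' may jump at \<open>t\<close>. Replacing h'(v) by the larger h'(u), with \<open>u\<close> fixed,
  dominates the gap by a function \<open>f\<close> that is continuous from the right at
  \<open>t\<close>.\<close>

lemma gap_right_limit:
  assumes t: "1 / (1 + r\<^sup>2) \<le> t" "s < t" "t < u" "u < 1"
    and gap: "\<And>v. t < v \<Longrightarrow> v < 1 \<Longrightarrow> 0 < gap r v"
  shows "Dsq t \<le> (t * (1 + r\<^sup>2) - 1) * (t * hder h u - h t + \<beta>)\<^sup>2"
proof -
  define f where "f v = (v * (1 + r\<^sup>2) - 1) * (v * hder h u - h v + \<beta>)\<^sup>2 - Dsq v" for v
  have r2: "0 < 1 + r\<^sup>2" by (simp add: add_pos_nonneg)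
  have "(f \<longlongrightarrow> f t) (at_right t)"
    unfolding f_def[abs_def]
    by (intro tendsto_intros tendsto_at_right_Icc[OF Dsq_tendsto] tendsto_at_right_Icc[OF h_tendsto])
       (use t s in auto)
  moreover have "eventually (\<lambda>v. 0 \<le> f v) (at_right t)"
  proof (rule eventually_mono[OF eventually_at_right_real[OF t(3)]])
    fix v assume v: "v \<in> {t<..<u}"
    then have v01: "0 < v" "v < 1" using t s by auto
    have "1 \<le> t * (1 + r\<^sup>2)" using t(1) r2 by (simp add: field_simps)
    also have "\<dots> \<le> v * (1 + r\<^sup>2)" using v r2 by (intro mult_right_mono) auto
    finally have w: "0 \<le> v * (1 + r\<^sup>2) - 1" by simp
    have "hder h v \<le> hder h u" using v v01 t by (intro hder_mono') auto
    then have "A v \<le> v * hder h u - h v + \<beta>"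
      using v01 by (simp add: A_def)
    moreover have "0 < A v" using v01 hderiv_neq_infinity[of v] by (intro A_pos) auto
    ultimately have "(A v)\<^sup>2 \<le> (v * hder h u - h v + \<beta>)\<^sup>2"
      by (intro power_mono) auto
    then have "gap r v \<le> f v"
      unfolding gap_def f_def using w by (simp add: mult_left_mono)
    then show "0 \<le> f v" using gap[of v] v v01 by simp
  qed
  ultimately have "0 \<le> f t"
    by (intro tendsto_lowerbound) auto
  then show ?thesis by (simp add: f_def)
qed

text \<open>The scale \<open>k\<close> solves the second moment equation k^2 Dsq(t) = \<mu>^2 w.
  Multiplied by \<mu>^2, the gap condition at \<open>t\<close> and the reverse bound to its right
  become, after square roots, \<open>below\<close> at \<open>t\<close> and
  \<open>above\<close>.\<close>

lemma truncated_profile_t_star: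
  assumes "0 < p" "c = p * \<beta>" "0 < \<mu>" "0 < \<sigma>" "r = \<sigma> / \<mu>" "s < 1 / (1 + r\<^sup>2)"
  defines "t \<equiv> t_star h \<beta> r s"
  defines "k \<equiv> sigma_t \<mu> \<sigma> t / Delta h \<beta> s t"
  shows "truncated_profile h p c \<mu> \<sigma> \<beta> s t k ((\<mu> + k * (h t - \<beta>)) / t)"
proof -
  have r: "0 < r" using assms by simp
  note T = t_star_properties[OF r assms(6), folded t_def]
  have st: "s < t" using T(1) assms(6) by simp
  then have t0: "0 < t" using s by simp
  have D: "0 < Dsq t" by (rule Dsq_pos[OF st T(2)])
  have mr: "\<mu>\<^sup>2 * (1 + r\<^sup>2) = \<mu>\<^sup>2 + \<sigma>\<^sup>2"
    using assms(3) by (simp add: assms(5) power_divide field_simps)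
  define w where "w = t * (1 + r\<^sup>2) - 1"
  have r2: "0 < 1 + r\<^sup>2" by (simp add: add_pos_nonneg)
  \<comment> \<open>At t = 1 this is r^2. Otherwise the positive \<open>Dsq t\<close> is bounded by
    \<open>w\<close> times a square, which forces w > 0.\<close>
  have w: "0 < w"
  proof (cases "t = 1")
    case True
    then show ?thesis using r by (simp add: w_def)
  next
    case False
    then have "t < 1" using T(2) by simp
    then obtain u where u: "t < u" "u < 1" using dense by blast
    have "0 < w * (t * hder h u - h t + \<beta>)\<^sup>2"
      using gap_right_limit[OF T(1) st u T(5)] D by (simp add: w_def)
    then show ?thesis by (simp add: zero_less_mult_iff)
  qed
  have sig: "t * (\<mu>\<^sup>2 + \<sigma>\<^sup>2) - \<mu>\<^sup>2 = \<mu>\<^sup>2 * w"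
    unfolding mr[symmetric] w_def by (simp add: algebra_simps)
  have k: "0 < k"
    unfolding k_def sigma_t_def sig Delta_eq[OF T(2)] using D w assms(3) by simp
  have k2: "k\<^sup>2 * Dsq t = \<mu>\<^sup>2 * w"
    unfolding k_def sigma_t_def sig Delta_eq[OF T(2)] using D w by (simp add: power_divide)
  have kk: "(k * x)\<^sup>2 * Dsq t = \<mu>\<^sup>2 * (w * x\<^sup>2)" for x
  proof -
    have "(k * x)\<^sup>2 * Dsq t = (k\<^sup>2 * Dsq t) * x\<^sup>2"
      by (simp add: power_mult_distrib)
    then show ?thesis unfolding k2 by simp
  qed
  have at: "k * A t \<le> \<mu>"
  proof (rule power2_le_imp_le)
    have "w * (A t)\<^sup>2 \<le> Dsq t" using T(4) by (simp add: gap_def w_def)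
    then have "\<mu>\<^sup>2 * (w * (A t)\<^sup>2) \<le> \<mu>\<^sup>2 * Dsq t" by (intro mult_left_mono) auto
    then have "(k * A t)\<^sup>2 * Dsq t \<le> \<mu>\<^sup>2 * Dsq t"
      unfolding kk .
    then show "(k * A t)\<^sup>2 \<le> \<mu>\<^sup>2" using D by simp
  qed (use assms in simp)
  have above: "\<mu> \<le> k * (t * hder h u - h t + \<beta>)" if u: "t < u" "u < 1" for u
  proof (rule power2_le_imp_le)
    have tu: "t < 1" using u by simp
    have "Dsq t \<le> w * (t * hder h u - h t + \<beta>)\<^sup>2"
      using gap_right_limit[OF T(1) st u T(5)] by (simp add: w_def)
    then have "\<mu>\<^sup>2 * Dsq t \<le> \<mu>\<^sup>2 * (w * (t * hder h u - h t + \<beta>)\<^sup>2)" by (intro mult_left_mono) auto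
    then have "\<mu>\<^sup>2 * Dsq t \<le> (k * (t * hder h u - h t + \<beta>))\<^sup>2 * Dsq t"
      unfolding kk .
    then show "\<mu>\<^sup>2 \<le> (k * (t * hder h u - h t + \<beta>))\<^sup>2" using D by simp
    have "A t \<le> t * hder h u - h t + \<beta>"
      using hder_mono'[of t u] u t0 by (simp add: A_def)
    then show "0 \<le> k * (t * hder h u - h t + \<beta>)"
      using A_pos[OF t0 T(2,3)] k by simp
  qed
  show ?thesis
  proof
    show "k\<^sup>2 * (t * J t - (h t - \<beta>)\<^sup>2) = t * (\<mu>\<^sup>2 + \<sigma>\<^sup>2) - \<mu>\<^sup>2"
      using k2 sig by (simp add: Dsq_def)
    show "t * ((\<mu> + k * (h t - \<beta>)) / t) = \<mu> + k * (h t - \<beta>)" using t0 by simp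
    show "k * hder h u \<le> (\<mu> + k * (h t - \<beta>)) / t" if u: "0 < u" "u < 1" "u \<le> t" for u
    proof -
      have "k * hder h u \<le> k * hder h t"
        using hder_mono[OF u(1,3) T(2,3)] k by simp
      also have "\<dots> \<le> (\<mu> + k * (h t - \<beta>)) / t"
        using at t0 by (simp add: A_def field_simps)
      finally show ?thesis .
    qed
    show "(\<mu> + k * (h t - \<beta>)) / t \<le> k * hder h u" if u: "t < u" "u < 1" for u
      using above[OF u] t0 by (simp add: field_simps)
  qed (use assms hs s st T k in auto)
qed

text \<open>With t = 1 nothing lies to the right, and by monotonicity nonnegativity reduces to u =
  1. The condition on h'(1) is conditional on \<sigma> > 0 because deterministic demand, with k = 0
  and a constant profile, belongs to case (ii) even for infinite h'(1).\<close>

lemma truncated_profile_1: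
  assumes "0 < p" "c = p * \<beta>" "0 < \<mu>" "0 \<le> \<sigma>"
    and nonneg: "0 < \<sigma> \<Longrightarrow> hderiv h 1 \<noteq> \<infinity> \<and> \<sigma> * (hder h 1 - (1 - \<beta>)) \<le> \<mu> * Delta h \<beta> s 1"
  defines "k \<equiv> \<sigma> / Delta h \<beta> s 1"
  shows "truncated_profile h p c \<mu> \<sigma> \<beta> s 1 k (\<mu> + k * (1 - \<beta>))"
proof
  have D: "0 < Dsq 1" by (rule Dsq_pos) (use s in auto)
  have \<Delta>: "0 < Delta h \<beta> s 1" using D by (simp add: Delta_eq)
  show k: "0 \<le> k" using \<Delta> assms(4) by (simp add: k_def)
  have "k\<^sup>2 * Dsq 1 = \<sigma>\<^sup>2"
    using D by (simp add: k_def Delta_eq power_divide)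
  then show "k\<^sup>2 * (1 * J 1 - (h 1 - \<beta>)\<^sup>2) = 1 * (\<mu>\<^sup>2 + \<sigma>\<^sup>2) - \<mu>\<^sup>2"
    by (simp add: Dsq_def)
  show "\<sigma> = 0" if "k = 0" using that \<Delta> by (simp add: k_def)
  show "k * hder h u \<le> \<mu> + k * (1 - \<beta>)" if u: "0 < u" "u < 1" for u
  proof (cases "\<sigma> = 0")
    case False
    then have n: "hderiv h 1 \<noteq> \<infinity>" "\<sigma> * (hder h 1 - (1 - \<beta>)) \<le> \<mu> * Delta h \<beta> s 1"
      using nonneg assms(4) by auto
    have "k * hder h u \<le> k * hder h 1"
      using hder_mono[of u 1] u n(1) k by (intro mult_left_mono) auto
    also have "\<dots> \<le> \<mu> + k * (1 - \<beta>)"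
      using n(2) \<Delta> by (simp add: k_def field_simps)
    finally show ?thesis .
  qed (use assms in \<open>simp add: k_def\<close>)
qed (use assms hs s in auto)

end

section \<open>The three regimes\<close>

theorem theorem3p1:
  fixes h :: "real \<Rightarrow> real" and p c \<mu> \<sigma> \<beta> r s t :: real
  assumes "0 < c" "c < p" "0 < \<mu>" "0 \<le> \<sigma>"
    and "\<beta> = c / p" "r = \<sigma> / \<mu>"
    and "convex_distortion_L2 h"
    and "s = inv_into {0..1} h \<beta>"
    and "t = t_star h \<beta> r s"
  shows
    "(r \<ge> sqrt (1 / s - 1) \<longrightarrow>
        rho_wc h p c \<mu> \<sigma> = 0 \<and>
        optimal_order h p c \<mu> \<sigma> 0 \<and>
        (\<exists>F. worst_case_law h p c \<mu> \<sigma> 0 F \<and>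
             measure F {(\<mu>\<^sup>2 + \<sigma>\<^sup>2) / \<mu>} = 1 / (1 + r\<^sup>2) \<and>
             measure F {0} = 1 - 1 / (1 + r\<^sup>2)))
     \<and>
     (ereal r \<le> ereal (Delta h \<beta> s 1) / (hderiv h 1 - ereal (1 - \<beta>)) \<longrightarrow>
        rho_wc h p c \<mu> \<sigma> = ereal (- \<mu> * (p - c) + p * \<sigma> * Delta h \<beta> s 1) \<and>
        (\<exists>F. (\<forall>u\<in>{0<..<1}. quantile F u =
                 \<mu> - \<sigma> * (hder h (1 - u) / Delta h \<beta> s 1) * indicator {..<1 - s} u
                   + \<sigma> * ((1 - \<beta>) / Delta h \<beta> s 1)) \<and>
             (\<forall>\<tau>. hderiv h s \<le> ereal \<tau> \<and> ereal \<tau> \<le> hderiv_right_limit h s \<longrightarrow>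
                (let x = \<mu> - \<sigma> * ((\<tau> - 2 * (1 - \<beta>)) / (2 * Delta h \<beta> s 1)) in
                   optimal_order h p c \<mu> \<sigma> x \<and> worst_case_law h p c \<mu> \<sigma> x F))))
     \<and>
     (ereal (Delta h \<beta> s 1) / (hderiv h 1 - ereal (1 - \<beta>)) < ereal r \<and> r < sqrt (1 / s - 1) \<longrightarrow>
        rho_wc h p c \<mu> \<sigma> =
          ereal (p / t * (- \<mu> * (h t - \<beta>) + sigma_t \<mu> \<sigma> t * Delta h \<beta> s t)) \<and>
        (\<exists>F. (\<forall>u\<in>{0<..<1}. quantile F u =
                 (if u < 1 - t then 0
                  else if u < 1 - s then
                    \<mu> / t - sigma_t \<mu> \<sigma> t / t
                              * ((t * hder h (1 - u) - (h t - \<beta>)) / Delta h \<beta> s t)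
                  else \<mu> / t + sigma_t \<mu> \<sigma> t / t * ((h t - \<beta>) / Delta h \<beta> s t))) \<and>
             (\<forall>\<tau>. hderiv h s \<le> ereal \<tau> \<and> ereal \<tau> \<le> hderiv_right_limit h s \<longrightarrow>
                (let x = \<mu> / t - sigma_t \<mu> \<sigma> t / t
                              * ((t * \<tau> - 2 * (h t - \<beta>)) / (2 * Delta h \<beta> s t)) in
                   optimal_order h p c \<mu> \<sigma> x \<and> worst_case_law h p c \<mu> \<sigma> x F))))"
proof -
  interpret distortion_L2 h by standard fact
  have p: "0 < p" using assms by simp
  then have c: "c = p * \<beta>" and \<beta>: "0 < \<beta>" "\<beta> < 1"
    using assms(1,2) by (simp_all add: assms(5))
  have "\<exists>x\<ge>0. x \<le> 1 \<and> h x = \<beta>"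
    by (rule IVT') (use \<beta> h_cont in auto)
  then have "\<beta> \<in> h ` {0..1}" by auto
  then have hs: "h s = \<beta>" and s01: "s \<in> {0..1}"
    unfolding assms(8) by (rule f_inv_into_f, rule inv_into_into)
  have s: "0 < s" "s < 1"
    using s01 hs \<beta> by (auto simp: less_le)
  interpret distortion_level h s \<beta>
    by standard (fact hs \<beta> s)+
  have r0: "0 \<le> r" using assms by simp
  have r2: "0 < 1 + r\<^sup>2" by (simp add: add_pos_nonneg)
  have t0: "1 / (1 + r\<^sup>2) = \<mu>\<^sup>2 / (\<mu>\<^sup>2 + \<sigma>\<^sup>2)"
    using assms(3) by (simp add: assms(6) field_simps)
  have s1: "0 < 1 / s - 1" using s by (simp add: field_simps)
  have \<Delta>: "0 < Delta h \<beta> s 1" using Dsq_pos[of 1] s by (simp add: Delta_eq)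
  have h'1: "1 \<le> hderiv h 1" using slope_le_hderiv[of 0 1] by (simp add: one_ereal_def)
  \<comment> \<open>Division by infinity gives 0: with an infinite h'(1), case (ii) means r = 0 and
    case (iii) asks for r > 0.\<close>
  have quotient: "ereal (Delta h \<beta> s 1) / (hderiv h 1 - ereal (1 - \<beta>))
      = (if hderiv h 1 = \<infinity> then 0 else ereal (Delta h \<beta> s 1 / (hder h 1 - (1 - \<beta>))))"
    using h'1 \<beta> by (cases "hderiv h 1") auto
  \<comment> \<open>Positive since h'(1) \<ge> 1, the slope of the chord over [0,1], and \<beta> >
    0.\<close>
  have D1: "0 < hder h 1 - (1 - \<beta>)" if "hderiv h 1 \<noteq> \<infinity>"
    using h'1 \<beta> that by (cases "hderiv h 1") (auto simp: one_ereal_def)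
  \<comment> \<open>The value is the same for all subgradients at \<open>s\<close>; h'(s) serves as
    one when only the value is asked for.\<close>
  note at_s = hder_mono'[OF _ _ s(2)] hder_mono'[OF s(1) less_imp_le]

  have case_i: "rho_wc h p c \<mu> \<sigma> = 0 \<and> optimal_order h p c \<mu> \<sigma> 0 \<and>
      (\<exists>F. worst_case_law h p c \<mu> \<sigma> 0 F \<and> measure F {(\<mu>\<^sup>2 + \<sigma>\<^sup>2) / \<mu>} = 1 / (1 + r\<^sup>2) \<and>
           measure F {0} = 1 - 1 / (1 + r\<^sup>2))"
    if r: "r \<ge> sqrt (1 / s - 1)"
  proof -
    have "1 / s - 1 \<le> r\<^sup>2"
      using power_mono[OF r, of 2] s1 by simp
    then have "1 / (1 + r\<^sup>2) \<le> s" using s r2 by (simp add: field_simps)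
    then have "\<mu>\<^sup>2 / (\<mu>\<^sup>2 + \<sigma>\<^sup>2) \<le> s" unfolding t0 .
    with two_point_law_optimal[OF p _ assms(3) refl this] show ?thesis
      unfolding t0 using c hs s by auto
  qed

  have case_ii: "rho_wc h p c \<mu> \<sigma> = ereal (- \<mu> * (p - c) + p * \<sigma> * Delta h \<beta> s 1) \<and>
        (\<exists>F. (\<forall>u\<in>{0<..<1}. quantile F u =
                 \<mu> - \<sigma> * (hder h (1 - u) / Delta h \<beta> s 1) * indicator {..<1 - s} u
                   + \<sigma> * ((1 - \<beta>) / Delta h \<beta> s 1)) \<and>
             (\<forall>\<tau>. hderiv h s \<le> ereal \<tau> \<and> ereal \<tau> \<le> hderiv_right_limit h s \<longrightarrow>
                (let x = \<mu> - \<sigma> * ((\<tau> - 2 * (1 - \<beta>)) / (2 * Delta h \<beta> s 1)) in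
                   optimal_order h p c \<mu> \<sigma> x \<and> worst_case_law h p c \<mu> \<sigma> x F)))"
    if r: "ereal r \<le> ereal (Delta h \<beta> s 1) / (hderiv h 1 - ereal (1 - \<beta>))"
  proof -
    define k where "k = \<sigma> / Delta h \<beta> s 1"
    define M where "M = \<mu> + k * (1 - \<beta>)"
    have "hderiv h 1 \<noteq> \<infinity> \<and> \<sigma> * (hder h 1 - (1 - \<beta>)) \<le> \<mu> * Delta h \<beta> s 1" if "0 < \<sigma>"
    proof -
      have "0 < r" using that assms by simp
      then have n: "hderiv h 1 \<noteq> \<infinity>" using r quotient by auto
      then have "r \<le> Delta h \<beta> s 1 / (hder h 1 - (1 - \<beta>))" using r quotient by simp
      then have "r * (hder h 1 - (1 - \<beta>)) \<le> Delta h \<beta> s 1"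
        using D1[OF n] by (simp add: pos_le_divide_eq)
      then show ?thesis
        using n assms(3) by (simp add: assms(6) field_simps)
    qed
    then interpret truncated_profile h p c \<mu> \<sigma> \<beta> s 1 k M
      unfolding k_def M_def by (intro truncated_profile_1[OF p c assms(3,4)]) auto
    have I2: "I2 = (Delta h \<beta> s 1)\<^sup>2 + (1 - \<beta>)\<^sup>2"
      using Dsq_pos[of 1] s by (simp add: Delta_eq Dsq_def)
    have sig: "\<sigma> = k * Delta h \<beta> s 1" using \<Delta> by (simp add: k_def)
    have val: "p * (k * I2 - M * (h 1 - \<beta>)) = - \<mu> * (p - c) + p * \<sigma> * Delta h \<beta> s 1"
      unfolding I2 sig M_def h_1 using c by (simp add: power2_eq_square algebra_simps)
    have rho: "rho_wc h p c \<mu> \<sigma> = ereal (- \<mu> * (p - c) + p * \<sigma> * Delta h \<beta> s 1)"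
      using profile_law_saddle(1)[OF at_s refl] unfolding val .
    have "quantile profile_law u =
                 \<mu> - \<sigma> * (hder h (1 - u) / Delta h \<beta> s 1) * indicator {..<1 - s} u
                   + \<sigma> * ((1 - \<beta>) / Delta h \<beta> s 1)" if u: "u \<in> {0<..<1}" for u
    proof -
      have "quantile profile_law u = M - k * hder h (1 - u) * indicator {..<1 - s} u"
        using quantile_profile_law[of "1 - u"] u by (auto simp: profile_def indicator_def)
      then show ?thesis by (simp add: M_def k_def)
    qed
    moreover have "let x = \<mu> - \<sigma> * ((\<tau> - 2 * (1 - \<beta>)) / (2 * Delta h \<beta> s 1)) in
        optimal_order h p c \<mu> \<sigma> x \<and> worst_case_law h p c \<mu> \<sigma> x profile_law"
      if tau: "hderiv h s \<le> ereal \<tau> \<and> ereal \<tau> \<le> hderiv_right_limit h s" for \<tau>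
    proof -
      have x: "\<mu> - \<sigma> * ((\<tau> - 2 * (1 - \<beta>)) / (2 * Delta h \<beta> s 1)) = M - k * \<tau> / 2"
        using \<Delta> by (simp add: M_def k_def field_simps)
      show ?thesis
        unfolding Let_def
        using profile_law_saddle(2,3)[OF subgradient_bounds[OF s] x] tau by blast
    qed
    ultimately show ?thesis using rho by blast
  qed

  have case_iii: "rho_wc h p c \<mu> \<sigma> =
          ereal (p / t * (- \<mu> * (h t - \<beta>) + sigma_t \<mu> \<sigma> t * Delta h \<beta> s t)) \<and>
        (\<exists>F. (\<forall>u\<in>{0<..<1}. quantile F u =
                 (if u < 1 - t then 0
                  else if u < 1 - s then
                    \<mu> / t - sigma_t \<mu> \<sigma> t / t
                              * ((t * hder h (1 - u) - (h t - \<beta>)) / Delta h \<beta> s t)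
                  else \<mu> / t + sigma_t \<mu> \<sigma> t / t * ((h t - \<beta>) / Delta h \<beta> s t))) \<and>
             (\<forall>\<tau>. hderiv h s \<le> ereal \<tau> \<and> ereal \<tau> \<le> hderiv_right_limit h s \<longrightarrow>
                (let x = \<mu> / t - sigma_t \<mu> \<sigma> t / t
                              * ((t * \<tau> - 2 * (h t - \<beta>)) / (2 * Delta h \<beta> s t)) in
                   optimal_order h p c \<mu> \<sigma> x \<and> worst_case_law h p c \<mu> \<sigma> x F)))"
    if r: "ereal (Delta h \<beta> s 1) / (hderiv h 1 - ereal (1 - \<beta>)) < ereal r" "r < sqrt (1 / s - 1)"
  proof -
    \<comment> \<open>The lower threshold is positive for finite h'(1) and 0 for infinite
      h'(1).\<close>
    have "0 < r"
    proof (cases "hderiv h 1 = \<infinity>")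
      case False
      have "0 < Delta h \<beta> s 1 / (hder h 1 - (1 - \<beta>))" using D1[OF False] \<Delta> by simp
      also have "\<dots> < r" using r(1) quotient False by simp
      finally show ?thesis .
    qed (use r(1) quotient in simp)
    then have \<sigma>: "0 < \<sigma>" using assms by (simp add: zero_less_divide_iff)
    have "r\<^sup>2 < 1 / s - 1"
      using power_strict_mono[OF r(2) r0, of 2] s1 by simp
    then have st0: "s < 1 / (1 + r\<^sup>2)" using s r2 by (simp add: field_simps)
    define k where "k = sigma_t \<mu> \<sigma> t / Delta h \<beta> s t"
    define M where "M = (\<mu> + k * (h t - \<beta>)) / t"
    interpret truncated_profile h p c \<mu> \<sigma> \<beta> s t k M
      unfolding k_def M_def assms(9)
      by (rule truncated_profile_t_star[OF p c assms(3) \<sigma> assms(6) st0])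
    have D: "0 < Dsq t" by (rule Dsq_pos[OF st(2,3)])
    then have \<Delta>t: "0 < Delta h \<beta> s t" and \<Delta>2: "(Delta h \<beta> s t)\<^sup>2 = t * I2 - (h t - \<beta>)\<^sup>2"
      using st(3) by (simp_all add: Delta_eq Dsq_def)
    have t: "0 < t" using st by simp
    have sig: "sigma_t \<mu> \<sigma> t = k * Delta h \<beta> s t" using \<Delta>t by (simp add: k_def)
    \<comment> \<open>The factor \<open>t\<close> allows \<open>mean\<close> to eliminate
      \<open>M\<close> and the definition of \<open>Delta\<close> to absorb
      \<open>t * I2\<close>.\<close>
    have "t * (k * I2 - M * (h t - \<beta>)) = k * (t * I2) - (t * M) * (h t - \<beta>)"
      by (simp add: algebra_simps)
    also have "\<dots> = - \<mu> * (h t - \<beta>) + k * (Delta h \<beta> s t)\<^sup>2"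
      unfolding mean \<Delta>2 by (simp add: power2_eq_square algebra_simps)
    also have "\<dots> = - \<mu> * (h t - \<beta>) + sigma_t \<mu> \<sigma> t * Delta h \<beta> s t"
      by (simp add: sig power2_eq_square)
    finally have V: "t * (k * I2 - M * (h t - \<beta>))
        = - \<mu> * (h t - \<beta>) + sigma_t \<mu> \<sigma> t * Delta h \<beta> s t" .
    have val: "p * (k * I2 - M * (h t - \<beta>))
        = p / t * (- \<mu> * (h t - \<beta>) + sigma_t \<mu> \<sigma> t * Delta h \<beta> s t)"
      unfolding V[symmetric] using t by simp
    have rho: "rho_wc h p c \<mu> \<sigma> =
        ereal (p / t * (- \<mu> * (h t - \<beta>) + sigma_t \<mu> \<sigma> t * Delta h \<beta> s t))"
      using profile_law_saddle(1)[OF at_s refl] unfolding val .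
    have low: "\<mu> / t - sigma_t \<mu> \<sigma> t / t * ((t * d - (h t - \<beta>)) / Delta h \<beta> s t) = M - k * d" for d
      using t \<Delta>t by (simp add: M_def k_def field_simps)
    have high: "\<mu> / t + sigma_t \<mu> \<sigma> t / t * ((h t - \<beta>) / Delta h \<beta> s t) = M"
      using t \<Delta>t by (simp add: M_def k_def field_simps)
    have "quantile profile_law u =
                 (if u < 1 - t then 0
                  else if u < 1 - s then
                    \<mu> / t - sigma_t \<mu> \<sigma> t / t
                              * ((t * hder h (1 - u) - (h t - \<beta>)) / Delta h \<beta> s t)
                  else \<mu> / t + sigma_t \<mu> \<sigma> t / t * ((h t - \<beta>) / Delta h \<beta> s t))"
      if u: "u \<in> {0<..<1}" for u
      unfolding low high using quantile_profile_law[of "1 - u"] u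
      by (auto simp: profile_def)
    moreover have "let x = \<mu> / t - sigma_t \<mu> \<sigma> t / t
                              * ((t * \<tau> - 2 * (h t - \<beta>)) / (2 * Delta h \<beta> s t)) in
        optimal_order h p c \<mu> \<sigma> x \<and> worst_case_law h p c \<mu> \<sigma> x profile_law"
      if tau: "hderiv h s \<le> ereal \<tau> \<and> ereal \<tau> \<le> hderiv_right_limit h s" for \<tau>
    proof -
      have x: "\<mu> / t - sigma_t \<mu> \<sigma> t / t * ((t * \<tau> - 2 * (h t - \<beta>)) / (2 * Delta h \<beta> s t))
          = M - k * \<tau> / 2"
        using t \<Delta>t by (simp add: M_def k_def field_simps)
      show ?thesis
        unfolding Let_def
        using profile_law_saddle(2,3)[OF subgradient_bounds[OF s] x] tau by blast
    qed
    ultimately show ?thesis using rho by blast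
  qed
  show ?thesis
    using case_i case_ii case_iii by blast
qed

end
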